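(* Let $J$ be a bounded block Jacobi matrix and let $z_0\in\mathbb R\setminus\sigma_{\mathrm{ess}}(J)$. For $k=0,1$, let $q_k$ be the multiplicity of $z_0$ as an eigenvalue of $J^{(k)}$. If $q_1-q_0\ge0$, then $\det(m(z))$ has a zero at $z=z_0$ of order $q_1-q_0$. If $q_1-q_0<0$, then $\det(m(z))$ has a pole at $z=z_0$ of order $q_0-q_1$.
   Context: Fix $l\ge1$. A bounded block Jacobi matrix with Jacobi parameters $(A_n,B_n)_{n\ge1}$ (complex $l\times l$ matrices with $B_n=B_n^\dagger$, $\det A_n\ne0$, $\sup_n(\|A_n\|+\|B_n\|)<\infty$) is the bounded self-adjoint operator $J$ on $\ell^2(\{1,2,\dots\};\mathbb C^l)$ given by $(Jf)_n=A_{n-1}^\dagger f_{n-1}+B_nf_n+A_nf_{n+1}$ with $f_0=0$. $J^{(0)}=J$, and $J^{(1)}$ is the once-stripped block Jacobi matrix, with Jacobi parameters $(A_{n+1},B_{n+1})_{n\ge1}$. The multiplicity of $z_0$ as an eigenvalue is the dimension of the eigenspace ($0$ if $z_0$ is not an eigenvalue). $\sigma_{\mathrm{ess}}$ denotes the essential spectrum. The $m$-function is the $l\times l$ matrix-valued function $m(z)=[(J-z)^{-1}]_{11}$ (the upper-left $l\times l$ block of the resolvent), analytic on $\mathbb C\setminus\sigma(J)$ and meromorphic near any $z_0\in\mathbb R\setminus\sigma_{\mathrm{ess}}(J)$. (Equivalently, $m(z)=\int\frac{d\mu(x)}{x-z}$ with $d\mu$ the matrix-valued spectral measure of $J$ for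 the first block coordinate.) A zero of order $0$ means that $\det(m(z))$ is finite and non-vanishing at $z_0$. *)

theory Defs
  imports
    "HOL-Complex_Analysis.Complex_Analysis"
    "HOL-Library.Function_Algebras"
begin

text \<open>
  Sequences indexed by $\{1,2,\dots\}$ are functions on \<^typ>\<open>nat\<close> that vanish at \<open>0\<close>; this
  builds in the convention $f_0 = 0$.  Parameters \<open>A 0\<close> and \<open>B 0\<close> exist but are never used.
  The block size $l$ is \<open>CARD('l)\<close>.
\<close>

definition seq_scale :: "complex \<Rightarrow> (nat \<Rightarrow> complex ^ 'l) \<Rightarrow> (nat \<Rightarrow> complex ^ 'l)" where
  "seq_scale c f = (\<lambda>n. c *s f n)"

interpretation seqs: vector_space "seq_scale :: complex \<Rightarrow> (nat \<Rightarrow> complex ^ 'l) \<Rightarrow> _"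
  by standard (simp_all add: seq_scale_def fun_eq_iff vec_eq_iff algebra_simps)

definition ell2 :: "(nat \<Rightarrow> complex ^ 'l) set" where
  "ell2 = {f. f 0 = 0 \<and> summable (\<lambda>n. (norm (f n))\<^sup>2)}"

definition ell2_norm :: "(nat \<Rightarrow> complex ^ 'l) \<Rightarrow> real" where
  "ell2_norm f = sqrt (\<Sum>n. (norm (f n))\<^sup>2)"


subsection \<open>Spectral notions for operators on \<open>ell2\<close>\<close>

definition resolvent_set :: "((nat \<Rightarrow> complex ^ 'l) \<Rightarrow> (nat \<Rightarrow> complex ^ 'l)) \<Rightarrow> complex set" where
  "resolvent_set T = {z. bij_betw (\<lambda>f. T f - seq_scale z f) ell2 ell2 \<and>
     (\<exists>C. \<forall>f\<in>ell2. ell2_norm f \<le> C * ell2_norm (T f - seq_scale z f))}"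

definition spectrum :: "((nat \<Rightarrow> complex ^ 'l) \<Rightarrow> (nat \<Rightarrow> complex ^ 'l)) \<Rightarrow> complex set" where
  "spectrum T = - resolvent_set T"

definition resolvent ::
  "((nat \<Rightarrow> complex ^ 'l) \<Rightarrow> (nat \<Rightarrow> complex ^ 'l)) \<Rightarrow> complex \<Rightarrow> (nat \<Rightarrow> complex ^ 'l) \<Rightarrow> (nat \<Rightarrow> complex ^ 'l)"
  where "resolvent T z = the_inv_into ell2 (\<lambda>f. T f - seq_scale z f)"

definition eigenspace ::
  "((nat \<Rightarrow> complex ^ 'l) \<Rightarrow> (nat \<Rightarrow> complex ^ 'l)) \<Rightarrow> complex \<Rightarrow> (nat \<Rightarrow> complex ^ 'l) set" where
  "eigenspace T z = {f \<in> ell2. T f = seq_scale z f}"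

text \<open>
  Complex dimension.  \<^term>\<open>seqs.dim\<close> of an infinite-dimensional space is \<open>0\<close>; this does not occur
  for block Jacobi matrices, whose eigenspaces have dimension at most $l$.
\<close>

definition multiplicity_eigval ::
  "((nat \<Rightarrow> complex ^ 'l) \<Rightarrow> (nat \<Rightarrow> complex ^ 'l)) \<Rightarrow> complex \<Rightarrow> nat" where
  "multiplicity_eigval T z = seqs.dim (eigenspace T z)"

text \<open>
  The discrete spectrum consists of the isolated points of the spectrum that are eigenvalues of
  finite multiplicity; for self-adjoint operators the essential spectrum is its complement in the
  spectrum.
\<close>

definition discrete_spectrum ::
  "((nat \<Rightarrow> complex ^ 'l) \<Rightarrow> (nat \<Rightarrow> complex ^ 'l)) \<Rightarrow> complex set" where
  "discrete_spectrum T = {z. z isolated_in spectrum T \<and> eigenspace T z \<noteq> {0} \<and>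
     (\<exists>S. finite S \<and> eigenspace T z \<subseteq> seqs.span S)}"

definition ess_spectrum ::
  "((nat \<Rightarrow> complex ^ 'l) \<Rightarrow> (nat \<Rightarrow> complex ^ 'l)) \<Rightarrow> complex set" where
  "ess_spectrum T = spectrum T - discrete_spectrum T"


subsection \<open>Block Jacobi matrices\<close>

definition ctranspose :: "complex ^ 'n ^ 'm \<Rightarrow> complex ^ 'm ^ 'n" where
  "ctranspose M = map_matrix cnj (transpose M)"

definition jacobi_params ::
  "(nat \<Rightarrow> complex ^ 'l ^ 'l) \<Rightarrow> (nat \<Rightarrow> complex ^ 'l ^ 'l) \<Rightarrow> bool" where
  "jacobi_params A B \<longleftrightarrow>
     (\<forall>n\<ge>1. B n = ctranspose (B n)) \<and> (\<forall>n\<ge>1. det (A n) \<noteq> 0) \<and>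
     bdd_above ((\<lambda>n. norm (A n) + norm (B n)) ` {1..})"

definition jacobi_op ::
  "(nat \<Rightarrow> complex ^ 'l ^ 'l) \<Rightarrow> (nat \<Rightarrow> complex ^ 'l ^ 'l) \<Rightarrow> (nat \<Rightarrow> complex ^ 'l) \<Rightarrow> (nat \<Rightarrow> complex ^ 'l)"
  where "jacobi_op A B f =
    (\<lambda>n. if n = 0 then 0
         else ctranspose (A (n - 1)) *v f (n - 1) + B n *v f n + A n *v f (n + 1))"

text \<open>The \<open>k\<close> times stripped block Jacobi matrix $J^{(k)}$.\<close>

definition stripped_jacobi_op ::
  "nat \<Rightarrow> (nat \<Rightarrow> complex ^ 'l ^ 'l) \<Rightarrow> (nat \<Rightarrow> complex ^ 'l ^ 'l) \<Rightarrow>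
     (nat \<Rightarrow> complex ^ 'l) \<Rightarrow> (nat \<Rightarrow> complex ^ 'l)" where
  "stripped_jacobi_op k A B = jacobi_op (\<lambda>n. A (n + k)) (\<lambda>n. B (n + k))"

definition first_site :: "complex ^ 'l \<Rightarrow> (nat \<Rightarrow> complex ^ 'l)" where
  "first_site v = (\<lambda>n. if n = 1 then v else 0)"

text \<open>
  The upper-left block of the resolvent.  It is only meaningful for \<open>z\<close> outside the spectrum of the
  Jacobi matrix.
\<close>

definition m_function ::
  "(nat \<Rightarrow> complex ^ 'l ^ 'l) \<Rightarrow> (nat \<Rightarrow> complex ^ 'l ^ 'l) \<Rightarrow> complex \<Rightarrow> complex ^ 'l ^ 'l" where
  "m_function A B z = (\<chi> i j. resolvent (jacobi_op A B) z (first_site (axis j 1)) 1 $ i)"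


subsection \<open>Orders of zeros and poles\<close>

text \<open>
  Both notions depend only on the values of \<open>f\<close> in a punctured neighbourhood of \<open>z0\<close>, so that a
  removable singularity is treated as removed.  In particular, a zero of order \<open>0\<close> means that
  \<open>f\<close> has a finite non-zero limit at \<open>z0\<close>.
\<close>

definition has_zero_of_order :: "(complex \<Rightarrow> complex) \<Rightarrow> complex \<Rightarrow> nat \<Rightarrow> bool" where
  "has_zero_of_order f z0 n \<longleftrightarrow>
     f meromorphic_on {z0} \<and> eventually (\<lambda>z. f z \<noteq> 0) (at z0) \<and> zorder f z0 = int n"

definition has_pole_of_order :: "(complex \<Rightarrow> complex) \<Rightarrow> complex \<Rightarrow> nat \<Rightarrow> bool" where
  "has_pole_of_order f z0 n \<longleftrightarrow>
     f meromorphic_on {z0} \<and> is_pole f z0 \<and> zorder f z0 = - int n"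

end

theory Submission
  imports Defs
begin

text \<open>
  The \<open>m\<close>-function is a quotient of two analytic matrix functions near \<open>z0\<close>, and their determinants
  vanish at \<open>z0\<close> exactly to the orders \<open>q 1\<close> and \<open>q 0\<close>.

  Suppose that for \<open>z\<close> near \<open>z0\<close> there are square-summable sequences \<open>F z v\<close>, analytic in \<open>z\<close> and linear in
  \<open>v\<close>, which solve \<open>(J - z) F = 0\<close> at every site but the first, where they leave a source \<open>X z v\<close>; let
  \<open>Y z v\<close> be the first entry of \<open>F z v\<close>; below, the three are \<open>weyl\<close>, \<open>weyl_source\<close> and
  \<open>weyl_value\<close>.  Applying the resolvent of \<open>J\<close> to the source gives
  \<open>m z X z = Y z\<close> (\<open>m_function_mult_weyl_source\<close>), hence \<open>det m = det Y / det X\<close>.  Vectors in the kernel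
  of \<open>X z0\<close> correspond to solutions without source, the eigenvectors of \<open>J\<close>
  (\<open>dim_kernel_weyl_source\<close>); vectors in the kernel of \<open>Y z0\<close> correspond to solutions that vanish at the
  first site, the eigenvectors of the stripped matrix (\<open>dim_kernel_weyl_value\<close>).  The determinant of an
  analytic matrix function vanishes exactly to the order of the dimension of its kernel if the derivative
  maps no nonzero kernel vector into the range (\<open>det_zero_order_kernel\<close>).  For \<open>X\<close> and \<open>Y\<close> this holds
  because a symmetric operator has no Jordan chains (\<open>weyl_no_jordan_chain\<close>).

  The sequences are \<open>F z v = inv (J + \<i> P - z) v\<close>, where \<open>P\<close> projects onto the first site and \<open>v\<close> is placed
  there.  So the remaining point is that \<open>J + \<i> P - z0\<close> is boundedly invertible
  (\<open>damped_boundedly_invertible\<close>).  It is injective, because a null vector vanishes at the first site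
  (\<open>damped_dissipative\<close>) and then solves \<open>J f = z0 f\<close> with first entry \<open>0\<close>, so that the
  recursion makes it vanish.  The lower bound needs that \<open>J - z0\<close> is invertible modulo its kernel, i.e. that an isolated point of the spectrum leaves a gap around it
  (\<open>symmetric_bounded_solution\<close>).  This is obtained from a sum-of-squares identity rather than from the
  spectral theorem: with \<open>B = J - z0\<close>, the resolvent bound at real points says that the quadratic forms
  of \<open>B\<^sup>2 - R B\<close> and \<open>B\<^sup>2 + R B\<close> are nonnegative, and a combination of the two gives
  \<open>norm (B (B f)) \<ge> R * norm (B f)\<close>.
\<close>

no_notation fps_nth (infixl \<open>$\<close> 75)

section \<open>Symmetric operators near an isolated point of the spectrum\<close>

lemma bij_bounded_perturbation:
  fixes T S :: "'a::banach \<Rightarrow> 'a"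
  assumes T: "linear T" "bij T" "\<And>f. c * norm f \<le> norm (T f)"
    and S: "linear S" "\<And>f. norm (S f) \<le> d * norm f" and d: "0 \<le> d" "d < c"
  shows "bij (\<lambda>f. T f + S f)"
proof -
  have c: "c > 0" using d by simp
  have contr: "norm (inv T f) \<le> norm f / c" for f
    using T(3)[of "inv T f"] c bij_inv_eq_iff[OF T(2)] by (metis mult.commute pos_le_divide_eq)
  have linv: "linear (inv T)"
  proof (rule linearI)
    show "inv T (f + g) = inv T f + inv T g" for f g
      by (intro inv_f_eq bij_is_inj[OF T(2)]) (simp add: linear_add[OF T(1)] surj_f_inv_f[OF bij_is_surj[OF T(2)]])
    show "inv T (s *\<^sub>R f) = s *\<^sub>R inv T f" for s f
      by (intro inv_f_eq bij_is_inj[OF T(2)]) (simp add: linear_scale[OF T(1)] surj_f_inv_f[OF bij_is_surj[OF T(2)]])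
  qed
  have "\<exists>!f. inv T (h - S f) = f" for h
  proof (rule banach_fix_type[where c="d/c"])
    show "0 \<le> d / c" "d / c < 1" using c d by auto
    show "\<forall>x y. dist (inv T (h - S x)) (inv T (h - S y)) \<le> d / c * dist x y"
    proof (intro allI)
      fix x y
      have "inv T (h - S x) - inv T (h - S y) = inv T (S (y - x))"
        by (simp add: linear_diff[OF linv, symmetric] linear_diff[OF S(1)])
      also have "norm \<dots> \<le> (d * norm (y - x)) / c"
        using contr[of "S (y - x)"] S(2)[of "y - x"] c by (meson divide_right_mono less_imp_le order_trans)
      finally show "dist (inv T (h - S x)) (inv T (h - S y)) \<le> d / c * dist x y"
        by (simp add: dist_norm norm_minus_commute)
    qed
  qed
  moreover have "inv T (h - S f) = f \<longleftrightarrow> T f + S f = h" for f h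
    using bij_inv_eq_iff[OF T(2), of f "h - S f"] by (simp add: eq_diff_eq eq_commute)
  ultimately show ?thesis
    unfolding bij_iff by simp
qed

text \<open>
  For a symmetric \<open>A\<close> with \<open>a = onorm A\<close> the number \<open>a\<^sup>2\<close> is an approximate eigenvalue of \<open>A\<^sup>2\<close>: expanding
  the square of the assumed lower bound gives
  \<open>k\<^sup>2 (norm f)\<^sup>2 \<le> 2 a\<^sup>4 (norm f)\<^sup>2 - 2 a\<^sup>2 (norm (A f))\<^sup>2\<close>, which would make the norm of \<open>A\<close> strictly
  smaller than \<open>a\<close>.
\<close>

lemma onorm_power2_not_regular:
  fixes A :: "'a::real_inner \<Rightarrow> 'a"
  assumes A: "bounded_linear A" and sym: "\<And>f g. inner (A f) g = inner f (A g)"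
    and k: "k > 0" "\<And>f. k * norm f \<le> norm (A (A f) - (onorm A)\<^sup>2 *\<^sub>R f)"
    and pos: "onorm A > 0"
  shows False
proof -
  define a where "a = onorm A"
  have a: "a > 0" using pos by (simp add: a_def)
  have bd: "norm (A f) \<le> a * norm f" for f
    unfolding a_def using onorm[OF A] by blast
  have "(k * norm f)\<^sup>2 \<le> 2 * a^4 * (norm f)\<^sup>2 - 2 * a\<^sup>2 * (norm (A f))\<^sup>2" for f
  proof -
    have "(k * norm f)\<^sup>2 \<le> (norm (A (A f) - a\<^sup>2 *\<^sub>R f))\<^sup>2"
      using k(2)[of f] k(1) unfolding a_def by (intro power_mono) auto
    also have "\<dots> = (norm (A (A f)))\<^sup>2 - 2 * a\<^sup>2 * inner (A f) (A f) + a^4 * (norm f)\<^sup>2"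
      unfolding power2_norm_eq_inner
      by (simp add: inner_diff_left inner_diff_right sym inner_commute[of "A (A f)" f] power2_eq_square power4_eq_xxxx algebra_simps)
    also have "(norm (A (A f)))\<^sup>2 \<le> (a * (a * norm f))\<^sup>2"
      using bd[of "A f"] bd[of f] a by (intro power_mono) (auto intro: order_trans mult_left_mono)
    finally show ?thesis
      by (simp add: power2_norm_eq_inner[of "A f"] algebra_simps)
  qed
  then have *: "(norm (A f))\<^sup>2 \<le> (a\<^sup>2 - k\<^sup>2 / (2 * a\<^sup>2)) * (norm f)\<^sup>2" for f
    using a by (simp add: field_simps power2_eq_square power4_eq_xxxx)
  define b where "b = a\<^sup>2 - k\<^sup>2 / (2 * a\<^sup>2)"
  have "norm (A f) \<le> sqrt (max 0 b) * norm f" for f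
  proof -
    have "(norm (A f))\<^sup>2 \<le> (sqrt (max 0 b) * norm f)\<^sup>2"
      using *[of f] unfolding b_def[symmetric] power_mult_distrib
      by (smt (verit) mult_right_mono real_sqrt_pow2 zero_le_power2)
    then show ?thesis
      by (meson max.cobounded1 mult_nonneg_nonneg norm_ge_zero power2_le_imp_le real_sqrt_ge_zero)
  qed
  then have "a \<le> sqrt (max 0 b)"
    unfolding a_def by (intro onorm_bound) auto
  moreover have "max 0 b < a\<^sup>2"
    using a k(1) by (auto simp: b_def)
  ultimately show False
    using a by (smt (verit) real_less_lsqrt real_sqrt_ge_zero)
qed

definition boundedly_invertible :: "('a::real_normed_vector \<Rightarrow> 'a) \<Rightarrow> bool" where
  "boundedly_invertible T \<longleftrightarrow> bij T \<and> (\<exists>c>0. \<forall>f. c * norm f \<le> norm (T f))"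

text \<open>
  The resolvent of a symmetric operator at a real point is bounded by the inverse distance to the
  spectrum, here to the possible spectral point \<open>0\<close>.  The inverse \<open>A\<close> of \<open>B - x\<close> is symmetric; if
  its norm \<open>a\<close> exceeded \<open>1 / \<bar>x\<bar>\<close>, then \<open>A - a\<close> and
  \<open>A + a\<close> would both be bounded below, because \<open>x + 1/a\<close> and \<open>x - 1/a\<close> are regular points of \<open>B\<close>, and
  their product \<open>A\<^sup>2 - a\<^sup>2\<close> would be bounded below as well.
\<close>

lemma symmetric_resolvent_bound:
  fixes B :: "'a::real_inner \<Rightarrow> 'a"
  assumes B: "linear B" and sym: "\<And>f g. inner (B f) g = inner f (B g)"
    and r: "\<And>x. x \<noteq> 0 \<Longrightarrow> \<bar>x\<bar> < 2 * r \<Longrightarrow> boundedly_invertible (\<lambda>f. B f - x *\<^sub>R f)"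
    and x: "\<bar>x\<bar> \<le> r"
  shows "\<bar>x\<bar> * norm f \<le> norm (B f - x *\<^sub>R f)"
proof (cases "x = 0")
  case False
  define T where "T = (\<lambda>f. B f - x *\<^sub>R f)"
  have linT: "linear T"
    unfolding T_def using B by (intro linear_compose_sub) (auto intro: linearI simp: algebra_simps)
  have symT: "inner (T f) g = inner f (T g)" for f g
    by (simp add: T_def sym inner_diff_left inner_diff_right)
  obtain c where bij: "bij T" and c: "c > 0" "\<And>f. c * norm f \<le> norm (T f)"
    using r[OF False] x False unfolding boundedly_invertible_def T_def by fastforce
  define A where "A = inv T"
  have TA [simp]: "T (A f) = f" and AT [simp]: "A (T f) = f" for f
    using bij by (auto simp: A_def bij_is_surj surj_f_inv_f bij_is_inj)
  have linA: "bounded_linear A"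
  proof (rule bounded_linear_intro[where K="1/c"])
    show "A (f + g) = A f + A g" for f g by (metis AT TA linear_add[OF linT])
    show "A (s *\<^sub>R f) = s *\<^sub>R A f" for s f by (metis AT TA linear_scale[OF linT])
    show "norm (A f) \<le> norm f * (1/c)" for f
      using c(2)[of "A f"] c(1) by (simp add: field_simps)
  qed
  then have linA': "linear A" by (simp add: bounded_linear.linear)
  have symA: "inner (A f) g = inner f (A g)" for f g by (metis TA symT)
  define a where "a = onorm A"
  have bd: "norm (A f) \<le> a * norm f" for f
    unfolding a_def using onorm[OF linA] by blast
  have "a \<le> 1 / \<bar>x\<bar>"
  proof (rule ccontr)
    assume "\<not> ?thesis"
    then have ax: "a > 1 / \<bar>x\<bar>" by simp
    then have a: "a > 0" using False by (smt (verit) zero_less_abs_iff zero_less_divide_1_iff)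
    have ax': "1 / a < \<bar>x\<bar>" using ax a False by (simp add: field_simps)
    \<comment> \<open>\<open>A - s\<close> is boundedly injective because \<open>x + 1/s\<close> lies in the punctured interval\<close>
    have below: "\<exists>k>0. \<forall>f. k * norm f \<le> norm (A f - s *\<^sub>R f)" if s: "\<bar>s\<bar> = a" for s
    proof -
      define y where "y = x + 1 / s"
      have s0: "s \<noteq> 0" using s a by auto
      have inv_s: "\<bar>1/s\<bar> = 1/a" using s by (simp add: abs_divide)
      have y: "y \<noteq> 0" "\<bar>y\<bar> < 2 * r" 
        using ax' inv_s x unfolding y_def by linarith+
      obtain k where k: "k > 0" "\<And>f. k * norm f \<le> norm (B f - y *\<^sub>R f)"
        using r[OF y] unfolding boundedly_invertible_def by blast
      show ?thesis
      proof (intro exI[of _ "a / (1 + 1 / (a * k))"] conjI allI)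
        show "a / (1 + 1 / (a * k)) > 0" using a k by (simp add: add_pos_pos)
        fix f
        define g where "g = A f"
        define h where "h = B g - y *\<^sub>R g"
        have f: "f = h + (1 / s) *\<^sub>R g"
          using TA[of f] by (simp add: T_def h_def g_def y_def algebra_simps)
        have "A f - s *\<^sub>R f = - s *\<^sub>R h"
          using s0 unfolding g_def[symmetric] by (simp add: f algebra_simps)
        then have 1: "norm (A f - s *\<^sub>R f) = a * norm h" using s by simp
        have "norm f \<le> norm h + (1/a) * norm g"
          using norm_triangle_ineq[of h "(1 / s) *\<^sub>R g"] inv_s by (simp add: f)
        also have "norm g \<le> norm h / k"
          using k(2)[of g] k(1) by (simp add: h_def field_simps)
        finally have "norm f \<le> norm h * (1 + 1 / (a * k))"
          using a k(1) by (simp add: field_simps)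
        then show "a / (1 + 1 / (a * k)) * norm f \<le> norm (A f - s *\<^sub>R f)"
          unfolding 1 using a k(1) by (simp add: pos_divide_le_eq add_pos_pos)
      qed
    qed
    obtain k1 where k1: "k1 > 0" "\<And>f. k1 * norm f \<le> norm (A f - a *\<^sub>R f)"
      using below[of a] a by auto
    obtain k2 where k2: "k2 > 0" "\<And>f. k2 * norm f \<le> norm (A f - (-a) *\<^sub>R f)"
      using below[of "-a"] a by auto
    \<comment> \<open>\<open>A\<^sup>2 - a\<^sup>2\<close> factors as \<open>(A - a) (A + a)\<close>\<close>
    show False
    proof (rule onorm_power2_not_regular[OF linA symA, of "k1 * k2"])
      show "k1 * k2 > 0" "onorm A > 0" using k1 k2 a by (auto simp: a_def)
      fix f
      define g where "g = A f - (-a) *\<^sub>R f"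
      have "k1 * k2 * norm f \<le> k1 * norm g"
        using k2(2)[of f] k1(1) by (simp add: g_def mult.assoc)
      also have "\<dots> \<le> norm (A g - a *\<^sub>R g)" by (rule k1)
      also have "A g - a *\<^sub>R g = A (A f) - (onorm A)\<^sup>2 *\<^sub>R f"
        unfolding g_def a_def[symmetric]
        by (simp add: linear_add[OF linA'] linear_scale[OF linA'] algebra_simps power2_eq_square)
      finally show "k1 * k2 * norm f \<le> norm (A (A f) - (onorm A)\<^sup>2 *\<^sub>R f)" .
    qed
  qed
  then have "norm f \<le> 1 / \<bar>x\<bar> * norm (T f)"
    using bd[of "T f"] by (metis AT mult_right_mono norm_ge_zero order_trans)
  then show ?thesis
    using False by (simp add: T_def field_simps)
qed simp

text \<open>
  Squaring the resolvent bound at \<open>x = r\<close> and \<open>x = - r\<close> shows that the quadratic forms of \<open>B\<^sup>2 - R B\<close> and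
  \<open>B\<^sup>2 + R B\<close> are nonnegative for \<open>R = 2 r\<close>.  Applied to \<open>(B + R) f\<close> and \<open>(B - R) f\<close> respectively and
  added, they give that \<open>B\<^sup>2 (B\<^sup>2 - R\<^sup>2)\<close> is nonnegative, because
  \<open>b (b - R) (b + R)\<^sup>2 + b (b + R) (b - R)\<^sup>2 = 2 b\<^sup>2 (b\<^sup>2 - R\<^sup>2)\<close>.
\<close>

lemma symmetric_spectral_gap:
  fixes B :: "'a::real_inner \<Rightarrow> 'a"
  assumes B: "linear B" and sym: "\<And>f g. inner (B f) g = inner f (B g)"
    and bd: "\<And>x f. \<bar>x\<bar> = r \<Longrightarrow> r * norm f \<le> norm (B f - x *\<^sub>R f)" and r: "r > 0"
  shows "2 * r * norm (B f) \<le> norm (B (B f))"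
proof -
  have pm: "2 * x * inner (B g) g \<le> (norm (B g))\<^sup>2" if "\<bar>x\<bar> = r" for x g
  proof -
    have "(r * norm g)\<^sup>2 \<le> (norm (B g - x *\<^sub>R g))\<^sup>2"
      using bd[OF that, of g] r by (intro power_mono) auto
    also have "\<dots> = (norm (B g))\<^sup>2 - 2 * x * inner (B g) g + x\<^sup>2 * (norm g)\<^sup>2"
      unfolding power2_norm_eq_inner
      by (simp add: inner_diff_left inner_diff_right inner_commute[of g "B g"] power2_eq_square algebra_simps)
    finally show ?thesis
      unfolding that[symmetric] by (simp add: power_mult_distrib)
  qed
  define R where "R = 2 * r"
  define g h where "g = B f + R *\<^sub>R f" and "h = B f - R *\<^sub>R f"
  have "R * inner (B g) g \<le> (norm (B g))\<^sup>2" "- R * inner (B h) h \<le> (norm (B h))\<^sup>2"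
    using pm[of r g] pm[of "-r" h] r by (auto simp: R_def)
  then have "0 \<le> ((norm (B g))\<^sup>2 - R * inner (B g) g) + ((norm (B h))\<^sup>2 + R * inner (B h) h)"
    by simp
  also have "\<dots> = 2 * ((norm (B (B f)))\<^sup>2 - R\<^sup>2 * (norm (B f))\<^sup>2)"
  proof -
    have 1: "inner (B (B f)) f = inner (B f) (B f)" by (simp add: sym)
    have 2: "inner (B f) f = inner f (B f)" by (simp add: sym)
    have 3: "inner f (B (B f)) = inner (B f) (B f)" by (simp add: sym)
    show ?thesis
    unfolding g_def h_def power2_norm_eq_inner
    by (simp add: linear_add[OF B] linear_diff[OF B] linear_scale[OF B] inner_add_left
        inner_add_right inner_diff_left inner_diff_right 1 2 3 inner_commute[of "B f" "B (B f)"]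
        power2_eq_square algebra_simps)
  qed
  finally have "(R * norm (B f))\<^sup>2 \<le> (norm (B (B f)))\<^sup>2" by (simp add: power_mult_distrib)
  then show ?thesis unfolding R_def by (rule power2_le_imp_le) simp
qed

text \<open>
  If \<open>0\<close> is at most an isolated point of the spectrum, then \<open>B\<close> has a bounded inverse modulo its kernel:
  \<open>s\<close> plays the role of the component of \<open>f\<close> orthogonal to the kernel.  It is the limit of
  \<open>B u\<close> with \<open>(B - x) u = f\<close>, as \<open>x\<close> tends to \<open>0\<close>; these vectors lie in the range of \<open>B\<close>, where the spectral gap
  turns convergence of their images under \<open>B\<close> into convergence of the vectors themselves.
\<close>

lemma symmetric_bounded_solution:
  fixes B :: "'a::{real_inner,banach} \<Rightarrow> 'a"
  assumes B: "linear B" and sym: "\<And>f g. inner (B f) g = inner f (B g)" and r: "r > 0"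
    and inv: "\<And>x. x \<noteq> 0 \<Longrightarrow> \<bar>x\<bar> < 2 * r \<Longrightarrow> boundedly_invertible (\<lambda>f. B f - x *\<^sub>R f)"
  shows "\<exists>s. B s = B f \<and> 2 * r * norm s \<le> norm (B f)"
proof -
  note bound = symmetric_resolvent_bound[OF B sym inv]
  have gap: "2 * r * norm (B f) \<le> norm (B (B f))" for f
    using r by (intro symmetric_spectral_gap[OF B sym]) (use bound in fastforce)+
  define x :: "nat \<Rightarrow> real" where "x = (\<lambda>n. r / real (Suc n))"
  have x: "x n > 0" "\<bar>x n\<bar> \<le> r" for n
    using r by (auto simp: x_def field_simps)
  have xlim: "x \<longlonglongrightarrow> 0"
    unfolding x_def by (rule lim_const_over_n[THEN LIMSEQ_Suc])
  have "\<exists>u. B u - x n *\<^sub>R u = f" for n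
    using inv[of "x n"] x[of n] r unfolding boundedly_invertible_def
    by (smt (verit) bij_pointE)
  then obtain u where u: "\<And>n. B (u n) - x n *\<^sub>R u n = f" by metis
  define s where "s = (\<lambda>n. B (u n))"
  have seq: "s n = f + x n *\<^sub>R u n" for n using u[of n] by (simp add: s_def algebra_simps)
  have Bs: "B (s n) = B f + x n *\<^sub>R s n" for n
    by (subst seq) (simp add: linear_add[OF B] linear_scale[OF B] s_def)
  have "x n * norm (u n) \<le> norm f" for n
    using bound[OF _ _ x(2)[of n], of "u n"] x(1)[of n] u[of n] by auto
  then have sbd: "norm (s n) \<le> 2 * norm f" for n
    using norm_triangle_ineq[of f "x n *\<^sub>R u n"] x(1)[of n] by (simp add: seq) (smt (verit))
  have xs: "(\<lambda>n. x n *\<^sub>R s n) \<longlonglongrightarrow> 0"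
  proof (rule Lim_null_comparison)
    show "\<forall>\<^sub>F n in sequentially. norm (x n *\<^sub>R s n) \<le> x n * (2 * norm f)"
      using x sbd by (intro always_eventually allI) (auto intro!: mult_mono simp: less_imp_le)
    show "(\<lambda>n. x n * (2 * norm f)) \<longlonglongrightarrow> 0"
      using tendsto_mult_right[OF xlim] by simp
  qed
  have Bslim: "(\<lambda>n. B (s n)) \<longlonglongrightarrow> B f"
    using tendsto_add[OF tendsto_const xs, of "B f"] by (simp add: Bs)
  have "Cauchy s"
  proof (rule metric_CauchyI)
    fix e :: real assume e: "e > 0"
    obtain M where M: "\<And>m n. m \<ge> M \<Longrightarrow> n \<ge> M \<Longrightarrow> dist (B (s m)) (B (s n)) < 2 * r * e"
      using metric_CauchyD[OF LIMSEQ_imp_Cauchy[OF Bslim], of "2*r*e"] e r by auto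
    have "dist (s m) (s n) < e" if "m \<ge> M" "n \<ge> M" for m n
    proof -
      have "2 * r * norm (s m - s n) \<le> norm (B (s m) - B (s n))"
        using gap[of "u m - u n"] by (simp add: linear_diff[OF B] s_def)
      also have "\<dots> < 2 * r * e" using M[OF that] by (simp add: dist_norm)
      finally show ?thesis using r by (simp add: dist_norm)
    qed
    then show "\<exists>M. \<forall>m\<ge>M. \<forall>n\<ge>M. dist (s m) (s n) < e" by blast
  qed
  then obtain t where t: "s \<longlonglongrightarrow> t" using Cauchy_convergent convergent_def by blast
  \<comment> \<open>a symmetric operator that is defined everywhere is closed\<close>
  have "inner (B t) g = inner (B f) g" for g
  proof (rule LIMSEQ_unique)
    show "(\<lambda>n. inner (s n) (B g)) \<longlonglongrightarrow> inner (B t) g"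
      using tendsto_inner[OF t tendsto_const, of "B g"] by (simp add: sym)
    show "(\<lambda>n. inner (s n) (B g)) \<longlonglongrightarrow> inner (B f) g"
      using tendsto_inner[OF Bslim tendsto_const, of g] by (simp add: sym)
  qed
  then have "inner (B t - B f) (B t - B f) = 0" by (simp add: inner_diff_left)
  then have "B t = B f" by simp
  moreover have "2 * r * norm t \<le> norm (B f)"
  proof (rule tendsto_le[OF _ tendsto_norm[OF Bslim]])
    show "(\<lambda>n. 2 * r * norm (s n)) \<longlonglongrightarrow> 2 * r * norm t" by (intro tendsto_intros t)
    show "\<forall>\<^sub>F n in sequentially. 2 * r * norm (s n) \<le> norm (B (s n))"
      using gap by (auto simp: s_def)
  qed simp
  ultimately show ?thesis by blast
qed

section \<open>Orders of determinants and quotients\<close>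

text \<open>
  A basis of \<open>K\<close>, extended to a basis of the whole space, gives the columns of an invertible matrix \<open>S\<close> in
  whose coordinates \<open>K\<close> is a coordinate subspace.
\<close>

lemma subspace_coordinate_matrix:
  fixes K :: "(complex ^ 'n) set"
  assumes K: "vec.subspace K"
  obtains S :: "complex ^ 'n ^ 'n" and D :: "'n set"
  where "invertible S" "card D = vec.dim K"
    "\<And>c. S *v c \<in> K \<longleftrightarrow> (\<forall>j. j \<notin> D \<longrightarrow> c $ j = 0)"
proof -
  obtain Bs where Bs: "Bs \<subseteq> K" "vec.independent Bs" "K \<subseteq> vec.span Bs" "card Bs = vec.dim K"
    using vec.basis_exists by blast
  define C where "C = vec.extend_basis Bs"
  have C: "Bs \<subseteq> C" "vec.independent C" "vec.span C = UNIV"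
    unfolding C_def using Bs(2) by (auto simp: vec.extend_basis_superset vec.independent_extend_basis)
  have finC: "finite C" using C(2) vec.finiteI_independent by blast
  have "card C = CARD('n)"
    using vec.dim_eq_card[of C UNIV] C by (simp add: card_cart_basis)
  then obtain b where b: "bij_betw b (UNIV :: 'n set) C"
    using finite_same_card_bij[OF finite finC] by metis
  define S :: "complex ^ 'n ^ 'n" where "S = (\<chi> i j. b j $ i)"
  define D where "D = {j. b j \<in> Bs}"
  have Sv: "S *v c = (\<Sum>j\<in>UNIV. c $ j *s b j)" for c
    by (simp add: matrix_mult_sum column_def S_def)
  have "columns S = C"
    using b by (auto simp: columns_def column_def S_def bij_betw_def)
  then obtain S' where S': "S ** S' = mat 1"
    using matrix_right_invertible_span_columns[of S] C(3) by blast
  then have S'': "S' ** S = mat 1" by (simp add: matrix_left_right_inverse)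
  have inv: "invertible S" using S' S'' unfolding invertible_def by blast
  have inj: "c = d" if "S *v c = S *v d" for c d
    using that S'' by (metis matrix_vector_mul_assoc matrix_vector_mul_lid)
  have bD: "bij_betw b D Bs"
    using b C(1) unfolding D_def bij_betw_def by (auto intro: inj_on_subset)
  show ?thesis
  proof (rule that[OF inv])
    show "card D = vec.dim K" using bij_betw_same_card[OF bD] Bs(4) by simp
    fix c :: "complex ^ 'n"
    show "S *v c \<in> K \<longleftrightarrow> (\<forall>j. j \<notin> D \<longrightarrow> c $ j = 0)"
    proof
      assume c: "\<forall>j. j \<notin> D \<longrightarrow> c $ j = 0"
      have "c $ j *s b j \<in> K" for j
        using c Bs(1) K by (cases "j \<in> D") (auto simp: D_def vec.subspace_scale vec.subspace_0)
      then show "S *v c \<in> K" unfolding Sv by (intro vec.subspace_sum[OF K]) auto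
    next
      assume "S *v c \<in> K"
      then obtain u where u: "S *v c = (\<Sum>v\<in>Bs. u v *s v)"
        using Bs(3) vec.span_finite[of Bs] finC C(1) finite_subset by blast
      define d :: "complex ^ 'n" where "d = (\<chi> j. if j \<in> D then u (b j) else 0)"
      have "(\<Sum>v\<in>Bs. u v *s v) = (\<Sum>j\<in>D. u (b j) *s b j)"
        using sum.reindex_bij_betw[OF bD, of "\<lambda>v. u v *s v"] by simp
      also have "\<dots> = (\<Sum>j\<in>UNIV. d $ j *s b j)"
        by (rule sum.mono_neutral_cong_left) (auto simp: d_def)
      finally have "S *v c = S *v d" by (simp only: u Sv[of d])
      then have "c = d" by (rule inj)
      then show "\<forall>j. j \<notin> D \<longrightarrow> c $ j = 0" by (simp add: d_def)
    qed
  qed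
qed

lemma matrix_vector_mult_axis_nth: "(M *v axis j 1) $ i = M $ i $ (j :: 'n::finite)"
  for M :: "'a::semiring_1 ^ 'n ^ 'm"
  by (simp add: matrix_vector_mult_def axis_def if_distrib cong: if_cong)

lemma det_columns_mul:
  fixes Q :: "'a::comm_ring_1 ^ 'n ^ 'n"
  shows "det (\<chi> i j. c j * Q $ i $ j) = (\<Prod>j\<in>UNIV. c j) * det Q"
proof -
  have "det (\<chi> i j. c j * Q $ i $ j) = det (transpose (\<chi> i j. c j * Q $ i $ j))"
    by (simp add: det_transpose)
  also have "transpose (\<chi> i j. c j * Q $ i $ j) = (\<chi> j. c j *s transpose Q $ j)"
    by (simp add: transpose_def vec_eq_iff)
  also have "det \<dots> = (\<Prod>j\<in>UNIV. c j) * det (transpose Q)"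
    by (subst det_rows_mul) (simp add: vec_nth_inverse)
  finally show ?thesis by (simp add: det_transpose)
qed

lemma holomorphic_on_det:
  assumes "\<And>i j. (\<lambda>z. M z $ i $ j) holomorphic_on U"
  shows "(\<lambda>z. det (M z :: complex ^ 'n ^ 'n)) holomorphic_on U"
  unfolding det_def by (intro holomorphic_intros assms)

text \<open>
  In general the determinant of an analytic matrix function can vanish to a higher order than the
  dimension of the kernel.  The hypothesis \<open>simple\<close> excludes this: in coordinates adapted to the kernel,
  the columns that belong to the kernel are divisible by \<open>z - z0\<close>, and after the division the matrix
  \<open>Q z0\<close> consists of derivative columns on the kernel and of value columns on a complement.  A null vector
  of \<open>Q z0\<close> therefore yields a pair \<open>k\<close>, \<open>k'\<close> as in the hypothesis.
\<close>

lemma det_zero_order_kernel: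
  fixes X :: "complex \<Rightarrow> complex ^ 'n ^ 'n" and X' :: "complex ^ 'n ^ 'n"
  assumes U: "open U" "z0 \<in> U"
    and hol: "\<And>i j. (\<lambda>z. X z $ i $ j) holomorphic_on U"
    and der: "\<And>i j. ((\<lambda>z. X z $ i $ j) has_field_derivative X' $ i $ j) (at z0)"
    and simple: "\<And>k k'. X z0 *v k = 0 \<Longrightarrow> X' *v k = X z0 *v k' \<Longrightarrow> k = 0"
  obtains g where "g holomorphic_on U" "g z0 \<noteq> 0"
    "\<And>z. z \<in> U \<Longrightarrow> det (X z) = (z - z0) ^ vec.dim {k. X z0 *v k = 0} * g z"
proof -
  define K where "K = {k. X z0 *v k = 0}"
  have "vec.subspace K"
    unfolding K_def vec.subspace_def
    by (auto simp: matrix_vector_right_distrib vector_scalar_commute matrix_vector_mult_0_right)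
  then obtain S :: "complex ^ 'n ^ 'n" and D where S: "invertible S" "card D = vec.dim K"
    "\<And>c. S *v c \<in> K \<longleftrightarrow> (\<forall>j. j \<notin> D \<longrightarrow> c $ j = 0)"
    using subspace_coordinate_matrix by blast
  define Y where "Y z = X z ** S" for z
  define Q :: "complex \<Rightarrow> complex ^ 'n ^ 'n" where
    "Q z = (\<chi> i j. if j \<in> D then
         (if z = z0 then deriv (\<lambda>w. Y w $ i $ j) z0 else (Y z $ i $ j - Y z0 $ i $ j) / (z - z0))
       else Y z $ i $ j)" for z
  have Ynth: "Y z $ i $ j = (\<Sum>k\<in>UNIV. X z $ i $ k * S $ k $ j)" for z i j
    by (simp add: Y_def matrix_matrix_mult_def)
  have Yhol: "(\<lambda>z. Y z $ i $ j) holomorphic_on U" for i j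
    unfolding Ynth by (intro holomorphic_intros hol)
  have "((\<lambda>z. Y z $ i $ j) has_field_derivative (X' ** S) $ i $ j) (at z0)" for i j
    unfolding Ynth by (auto intro!: derivative_eq_intros der simp: matrix_matrix_mult_def)
  then have Yder: "deriv (\<lambda>z. Y z $ i $ j) z0 = (X' ** S) $ i $ j" for i j
    by (rule DERIV_imp_deriv)
  have Qhol: "(\<lambda>z. Q z $ i $ j) holomorphic_on U" for i j
  proof (cases "j \<in> D")
    case True
    then show ?thesis
      using pole_lemma_open[OF Yhol[of i j] U(1), of z0] by (simp add: Q_def)
  next
    case False
    then show ?thesis using Yhol[of i j] by (simp add: Q_def)
  qed
  have Y0: "Y z0 $ i $ j = 0" if "j \<in> D" for i j
  proof -
    have "S *v axis j 1 \<in> K" using that by (auto simp: S(3) axis_def)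
    then have "Y z0 *v axis j 1 = 0" by (simp add: K_def Y_def matrix_vector_mul_assoc)
    then show ?thesis by (metis matrix_vector_mult_axis_nth zero_index)
  qed
  have YQ: "Y z = (\<chi> i j. (if j \<in> D then z - z0 else 1) * Q z $ i $ j)" for z
    by (auto simp: vec_eq_iff Q_def Y0)
  have detY: "det (Y z) = (z - z0) ^ vec.dim K * det (Q z)" for z
    unfolding S(2)[symmetric]
    by (subst YQ, subst det_columns_mul) (simp add: prod.If_cases)
  have "det (Q z0) \<noteq> 0"
  proof -
    have "c = 0" if Qc: "Q z0 *v c = 0" for c
    proof -
      \<comment> \<open>split \<open>c\<close> into kernel coordinates and complementary coordinates\<close>
      define c1 c2 :: "complex ^ 'n"
        where "c1 = (\<chi> j. if j \<in> D then c $ j else 0)" and "c2 = (\<chi> j. if j \<in> D then 0 else c $ j)"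
      have cc: "c = c1 + c2" by (simp add: c1_def c2_def vec_eq_iff)
      have "Q z0 *v c = (X' ** S) *v c1 + Y z0 *v c2"
        by (auto simp: vec_eq_iff matrix_vector_mult_def Q_def Yder c1_def c2_def simp flip: sum.distrib
            intro!: sum.cong)
      then have "X' *v (S *v c1) = X z0 *v (S *v (- c2))"
        using Qc by (simp add: Y_def matrix_vector_mul_assoc matrix_vector_mult_diff_distrib eq_neg_iff_add_eq_0 vec.neg)
      moreover have Sc1: "S *v c1 \<in> K" by (simp add: S(3) c1_def)
      ultimately have "S *v c1 = 0" using simple by (auto simp: K_def)
      then have c1: "c1 = 0" using S(1) by (metis invertible_def matrix_vector_mul_assoc matrix_vector_mul_lid matrix_vector_mult_0_right)
      then have "X z0 *v (S *v c) = 0"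
        using \<open>X' *v (S *v c1) = X z0 *v (S *v (- c2))\<close> by (simp add: cc vec.neg)
      then have "\<forall>j. j \<notin> D \<longrightarrow> c $ j = 0" using S(3) by (auto simp: K_def)
      then have "c2 = 0" by (simp add: c2_def vec_eq_iff)
      then show "c = 0" using c1 cc by simp
    qed
    then have "invertible (Q z0)" by (simp add: invertible_left_inverse matrix_left_invertible_ker)
    then show ?thesis by (simp add: invertible_det_nz)
  qed
  moreover have detS: "det S \<noteq> 0" using S(1) by (simp add: invertible_det_nz)
  moreover have "det (X z) = (z - z0) ^ vec.dim K * (det (Q z) / det S)" for z
    using detY[of z] detS by (simp add: Y_def det_mul field_simps)
  moreover have "(\<lambda>z. det (Q z) / det S) holomorphic_on U"
    using detS by (intro holomorphic_intros holomorphic_on_det Qhol)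
  ultimately show ?thesis
    by (intro that[of "\<lambda>z. det (Q z) / det S"]) (auto simp: K_def)
qed

lemma order_of_quotient:
  fixes f g h :: "complex \<Rightarrow> complex"
  assumes U: "open U" "z0 \<in> U"
    and gh: "g holomorphic_on U" "g z0 \<noteq> 0" "h holomorphic_on U" "h z0 \<noteq> 0"
    and f: "\<And>z. z \<in> U \<Longrightarrow> z \<noteq> z0 \<Longrightarrow> f z * ((z - z0) ^ p * g z) = (z - z0) ^ q * h z"
  shows "(p \<le> q \<longrightarrow> has_zero_of_order f z0 (q - p)) \<and> (q < p \<longrightarrow> has_pole_of_order f z0 (p - q))"
proof -
  define V where "V = {z \<in> U. g z \<noteq> 0} \<inter> {z \<in> U. h z \<noteq> 0}"
  have nz_open: "open {z \<in> U. f z \<noteq> 0}" if "f holomorphic_on U" for f :: "complex \<Rightarrow> complex"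
    using continuous_open_preimage[OF holomorphic_on_imp_continuous_on[OF that] U(1), of "- {0}"]
    by (simp add: Collect_conj_eq vimage_def open_Compl)
  have V: "open V" "z0 \<in> V" "V \<subseteq> U"
    unfolding V_def using U gh by (auto intro!: open_Int nz_open)
  define k where "k z = h z / g z" for z
  have k: "k holomorphic_on V" "k z0 \<noteq> 0"
    unfolding k_def using gh V by (auto intro!: holomorphic_intros simp: V_def elim: holomorphic_on_subset)
  have fk: "f z = k z * (z - z0) powi (int q - int p)" if "z \<in> V" "z \<noteq> z0" for z
    using f[of z] that by (auto simp: V_def k_def power_int_diff field_simps)
  have ev: "\<forall>\<^sub>F z in at z0. z \<in> V \<and> z \<noteq> z0"
    using V by (simp add: eventually_at_topological) blast
  have "(\<lambda>z. k z * (z - z0) powi (int q - int p)) meromorphic_on {z0}"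
    using k(1) V by (intro meromorphic_intros) (auto intro!: analytic_on_imp_meromorphic_on simp: analytic_at)
  then have mero: "f meromorphic_on {z0}"
    by (rule meromorphic_on_cong[THEN iffD1, rotated 2]) (use ev fk in \<open>auto elim!: eventually_mono\<close>)
  have ord: "zorder f z0 = int q - int p"
    by (rule zorder_eqI[OF V(1,2) k]) (use fk in auto)
  have nz: "\<forall>\<^sub>F z in at z0. f z \<noteq> 0"
    using ev by eventually_elim (use fk in \<open>auto simp: V_def k_def\<close>)
  have "is_pole f z0" if "q < p"
    using that ord nz mero by (intro zorder_neg_imp_is_pole) (auto simp: eventually_frequently)
  then show ?thesis
    using mero ord nz unfolding has_zero_of_order_def has_pole_of_order_def by auto
qed

section \<open>Square-summable sequences as a Hilbert space\<close>

lemma ell2_0: "0 \<in> ell2"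
  by (simp add: ell2_def)

lemma ell2_summable: "f \<in> ell2 \<Longrightarrow> summable (\<lambda>n. (norm (f n))\<^sup>2)"
  by (simp add: ell2_def)

lemma power2_norm_add_le: "(norm (x + y))\<^sup>2 \<le> 2 * (norm x)\<^sup>2 + 2 * (norm y)\<^sup>2"
  for x y :: "'a::real_normed_vector"
proof -
  have "(norm (x + y))\<^sup>2 \<le> (norm x + norm y)\<^sup>2"
    by (intro power_mono norm_triangle_ineq) auto
  also have "\<dots> \<le> 2 * (norm x)\<^sup>2 + 2 * (norm y)\<^sup>2"
    using zero_le_power2[of "norm x - norm y"] by (simp add: power2_eq_square algebra_simps)
  finally show ?thesis .
qed

lemma ell2_add:
  assumes "f \<in> ell2" "g \<in> ell2"
  shows "f + g \<in> ell2"
proof -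
  have "summable (\<lambda>n. (norm ((f + g) n))\<^sup>2)"
  proof (rule summable_comparison_test')
    show "summable (\<lambda>n. 2 * (norm (f n))\<^sup>2 + 2 * (norm (g n))\<^sup>2)"
      using assms by (intro summable_add summable_mult ell2_summable)
    show "norm ((norm ((f + g) n))\<^sup>2) \<le> 2 * (norm (f n))\<^sup>2 + 2 * (norm (g n))\<^sup>2" for n
      using power2_norm_add_le[of "f n" "g n"] by simp
  qed
  then show ?thesis using assms by (simp add: ell2_def)
qed

lemma norm_vector_scale: "norm (c *s x) = norm c * norm x" for x :: "complex ^ 'n"
  by (simp add: norm_vec_def L2_set_def norm_mult power_mult_distrib real_sqrt_mult flip: sum_distrib_left)

lemma ell2_seq_scale:
  assumes "f \<in> ell2"
  shows "seq_scale c f \<in> ell2"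
  using assms by (auto simp: ell2_def seq_scale_def norm_vector_scale power_mult_distrib intro: summable_mult)

lemma ell2_minus: "f \<in> ell2 \<Longrightarrow> - f \<in> ell2"
  by (simp add: ell2_def)

lemma ell2_diff: "f \<in> ell2 \<Longrightarrow> g \<in> ell2 \<Longrightarrow> f - g \<in> ell2"
  using ell2_add[of f "- g"] ell2_minus[of g] by simp

lemma ell2_scaleR: 
  assumes "f \<in> ell2"
  shows "(\<lambda>n. r *\<^sub>R f n) \<in> ell2"
  using assms by (auto simp: ell2_def power_mult_distrib intro: summable_mult)

lemma summable_inner_ell2:
  assumes "f \<in> ell2" "g \<in> ell2"
  shows "summable (\<lambda>n. inner (f n) (g n))"
proof (rule summable_comparison_test')
  show "summable (\<lambda>n. (norm (f n))\<^sup>2 + (norm (g n))\<^sup>2)"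
    using assms by (intro summable_add ell2_summable)
  show "norm (inner (f n) (g n)) \<le> (norm (f n))\<^sup>2 + (norm (g n))\<^sup>2" for n
    using Cauchy_Schwarz_ineq2[of "f n" "g n"] sum_squares_bound[of "norm (f n)" "norm (g n)"]
      mult_nonneg_nonneg[OF norm_ge_zero[of "f n"] norm_ge_zero[of "g n"]]
    unfolding real_norm_def by linarith
qed

text \<open>
  A type copy of \<^const>\<open>ell2\<close> makes the square-summable sequences a real Hilbert space in the sense of the
  type classes.  The inner product is the real part of the usual complex one, which suffices for every
  orthogonality argument below; complex multiples act through a separate operation.
\<close>

typedef (overloaded) 'l lseq = "ell2 :: (nat \<Rightarrow> complex ^ 'l) set"
  by (rule exI[of _ 0]) (rule ell2_0)

setup_lifting type_definition_lseq

instantiation lseq :: (finite) real_vector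
begin

lift_definition zero_lseq :: "'a lseq" is 0 by (rule ell2_0)
lift_definition plus_lseq :: "'a lseq \<Rightarrow> 'a lseq \<Rightarrow> 'a lseq" is "(+)" by (rule ell2_add)
lift_definition minus_lseq :: "'a lseq \<Rightarrow> 'a lseq \<Rightarrow> 'a lseq" is "(-)" by (rule ell2_diff)
lift_definition uminus_lseq :: "'a lseq \<Rightarrow> 'a lseq" is uminus by (rule ell2_minus)
lift_definition scaleR_lseq :: "real \<Rightarrow> 'a lseq \<Rightarrow> 'a lseq" is "\<lambda>r f n. r *\<^sub>R f n"
  by (rule ell2_scaleR)
instance
proof
  fix f g h :: "'a lseq" and r s :: real
  show "f + g + h = f + (g + h)" "f + g = g + f" "0 + f = f" "- f + f = 0" "f - g = f + - g"
    by (transfer; simp add: algebra_simps)+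
  show "r *\<^sub>R (f + g) = r *\<^sub>R f + r *\<^sub>R g" "(r + s) *\<^sub>R f = r *\<^sub>R f + s *\<^sub>R f"
    "r *\<^sub>R s *\<^sub>R f = (r * s) *\<^sub>R f" "1 *\<^sub>R f = f"
    by (transfer; simp add: fun_eq_iff algebra_simps)+
qed

end

instantiation lseq :: (finite) real_inner
begin

lift_definition inner_lseq :: "'a lseq \<Rightarrow> 'a lseq \<Rightarrow> real" is "\<lambda>f g. \<Sum>n. inner (f n) (g n)" .
definition norm_lseq :: "'a lseq \<Rightarrow> real" where "norm_lseq f = sqrt (inner f f)"
definition sgn_lseq :: "'a lseq \<Rightarrow> 'a lseq" where "sgn_lseq f = f /\<^sub>R norm f"
definition dist_lseq :: "'a lseq \<Rightarrow> 'a lseq \<Rightarrow> real" where "dist_lseq f g = norm (f - g)"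
definition uniformity_lseq :: "('a lseq \<times> 'a lseq) filter" where
  "uniformity_lseq = (INF e\<in>{0<..}. principal {(x, y). dist x y < e})"
definition open_lseq :: "'a lseq set \<Rightarrow> bool" where
  "open_lseq U = (\<forall>x\<in>U. eventually (\<lambda>(x', y). x' = x \<longrightarrow> y \<in> U) uniformity)"

instance
proof
  fix f g h :: "'a lseq" and r :: real
  show "dist f g = norm (f - g)" by (simp add: dist_lseq_def)
  show "sgn f = f /\<^sub>R norm f" by (simp add: sgn_lseq_def)
  show "uniformity = (INF e\<in>{0<..}. principal {(x, y). dist x (y::'a lseq) < e})"
    by (simp add: uniformity_lseq_def)
  show "open U = (\<forall>x\<in>U. eventually (\<lambda>(x', y). x' = x \<longrightarrow> y \<in> U) uniformity)" for U :: "'a lseq set"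
    by (simp add: open_lseq_def)
  show "norm f = sqrt (inner f f)" by (simp add: norm_lseq_def)
  show "inner f g = inner g f" by transfer (simp add: inner_commute)
  show "inner (f + g) h = inner f h + inner g h"
    by transfer (simp add: inner_add_left suminf_add summable_inner_ell2)
  show "inner (r *\<^sub>R f) g = r * inner f g"
    by transfer (simp add: suminf_mult summable_inner_ell2)
  show "0 \<le> inner f f"
    by transfer (simp add: suminf_nonneg summable_inner_ell2)
  show "inner f f = 0 \<longleftrightarrow> f = 0"
  proof
    assume "inner f f = 0"
    then have "\<forall>n. inner (Rep_lseq f n) (Rep_lseq f n) = 0"
      by transfer (subst (asm) suminf_eq_zero_iff; simp add: summable_inner_ell2)
    then show "f = 0" by transfer (simp add: fun_eq_iff)
  qed (transfer; simp)
qed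

end

lemma norm_lseq_eq: "norm f = ell2_norm (Rep_lseq f)"
  by (simp add: norm_lseq_def ell2_norm_def inner_lseq.rep_eq power2_norm_eq_inner)

lemma power2_norm_lseq: "(norm f)\<^sup>2 = (\<Sum>n. (norm (Rep_lseq f n))\<^sup>2)"
  by (simp add: power2_norm_eq_inner inner_lseq.rep_eq)

lemma summable_norm_lseq: "summable (\<lambda>n. (norm (Rep_lseq f n))\<^sup>2)"
  using Rep_lseq[of f] by (rule ell2_summable)

lemma norm_lseq_nth_le: "norm (Rep_lseq f n) \<le> norm f"
proof (rule power2_le_imp_le)
  show "(norm (Rep_lseq f n))\<^sup>2 \<le> (norm f)\<^sup>2"
    unfolding power2_norm_lseq using sum_le_suminf[OF summable_norm_lseq, of "{n}" f] by simp
qed simp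

instance lseq :: (finite) banach
proof
  fix X :: "nat \<Rightarrow> 'a lseq"
  assume X: "Cauchy X"
  \<comment> \<open>coordinatewise limits exist\<close>
  have "Cauchy (\<lambda>m. Rep_lseq (X m) n)" for n
  proof (rule metric_CauchyI)
    fix e :: real assume "e > 0"
    then obtain M where M: "\<And>m k. m \<ge> M \<Longrightarrow> k \<ge> M \<Longrightarrow> norm (X m - X k) < e"
      using metric_CauchyD[OF X] unfolding dist_norm by blast
    have "dist (Rep_lseq (X m) n) (Rep_lseq (X k) n) < e" if "m \<ge> M" "k \<ge> M" for m k
      using norm_lseq_nth_le[of "X m - X k" n] M[OF that] by (simp add: dist_norm minus_lseq.rep_eq)
    then show "\<exists>M. \<forall>m\<ge>M. \<forall>k\<ge>M. dist (Rep_lseq (X m) n) (Rep_lseq (X k) n) < e" by blast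
  qed
  then have "\<forall>n. \<exists>l. (\<lambda>m. Rep_lseq (X m) n) \<longlonglongrightarrow> l"
    using Cauchy_convergent convergent_def by blast
  then obtain f where f: "\<And>n. (\<lambda>m. Rep_lseq (X m) n) \<longlonglongrightarrow> f n" by metis
  \<comment> \<open>passing to the limit in the Cauchy condition, first for finitely many coordinates\<close>
  have tail: "\<exists>M. \<forall>m\<ge>M. Rep_lseq (X m) - f \<in> ell2 \<and> (\<Sum>n. (norm (Rep_lseq (X m) n - f n))\<^sup>2) \<le> e\<^sup>2"
    if e: "e > 0" for e
  proof -
    obtain M where M: "\<And>m k. m \<ge> M \<Longrightarrow> k \<ge> M \<Longrightarrow> norm (X m - X k) < e"
      using metric_CauchyD[OF X e] unfolding dist_norm by blast
    have part: "(\<Sum>n<N. (norm (Rep_lseq (X m) n - f n))\<^sup>2) \<le> e\<^sup>2" if m: "m \<ge> M" for m N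
    proof (rule tendsto_upperbound)
      show "(\<lambda>k. \<Sum>n<N. (norm (Rep_lseq (X m) n - Rep_lseq (X k) n))\<^sup>2)
              \<longlonglongrightarrow> (\<Sum>n<N. (norm (Rep_lseq (X m) n - f n))\<^sup>2)"
        by (intro tendsto_intros f)
      show "\<forall>\<^sub>F k in sequentially. (\<Sum>n<N. (norm (Rep_lseq (X m) n - Rep_lseq (X k) n))\<^sup>2) \<le> e\<^sup>2"
      proof (rule eventually_sequentiallyI[of M])
        fix k assume k: "k \<ge> M"
        have "(\<Sum>n<N. (norm (Rep_lseq (X m - X k) n))\<^sup>2) \<le> (norm (X m - X k))\<^sup>2"
          unfolding power2_norm_lseq by (intro sum_le_suminf summable_norm_lseq) auto
        also have "\<dots> \<le> e\<^sup>2" using M[OF m k] by (intro power_mono) auto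
        finally show "(\<Sum>n<N. (norm (Rep_lseq (X m) n - Rep_lseq (X k) n))\<^sup>2) \<le> e\<^sup>2"
          by (simp add: minus_lseq.rep_eq)
      qed
    qed simp
    have "Rep_lseq (X m) 0 = 0" for m using Rep_lseq[of "X m"] by (simp add: ell2_def)
    then have f0: "f 0 = 0" using f[of 0] by (simp add: LIMSEQ_const_iff)
    have "summable (\<lambda>n. (norm (Rep_lseq (X m) n - f n))\<^sup>2)" if "m \<ge> M" for m
      using part[OF that] by (intro summableI_nonneg_bounded[where x="e\<^sup>2"]) auto
    then show ?thesis
      using part f0 Rep_lseq by (intro exI[of _ M]) (auto simp: ell2_def intro!: suminf_le_const)
  qed
  from tail[of 1] obtain M where "Rep_lseq (X M) - f \<in> ell2" by auto
  then have f2: "f \<in> ell2" using ell2_diff[OF Rep_lseq[of "X M"]] by fastforce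
  have "X \<longlonglongrightarrow> Abs_lseq f"
  proof (rule LIMSEQ_I)
    fix e :: real assume e: "e > 0"
    then obtain M where M: "\<And>m. m \<ge> M \<Longrightarrow> (\<Sum>n. (norm (Rep_lseq (X m) n - f n))\<^sup>2) \<le> (e/2)\<^sup>2"
      using tail[of "e/2"] by auto
    have "norm (X m - Abs_lseq f) < e" if "m \<ge> M" for m
    proof -
      have "(norm (X m - Abs_lseq f))\<^sup>2 \<le> (e/2)\<^sup>2"
        using M[OF that] by (simp add: power2_norm_lseq minus_lseq.rep_eq Abs_lseq_inverse f2)
      then have "norm (X m - Abs_lseq f) \<le> e / 2" by (rule power2_le_imp_le) (use e in simp)
      then show ?thesis using e by simp
    qed
    then show "\<exists>M. \<forall>m\<ge>M. norm (X m - Abs_lseq f) < e" by blast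
  qed
  then show "convergent X" by (auto simp: convergent_def)
qed

lift_definition cscale :: "complex \<Rightarrow> ('l::finite) lseq \<Rightarrow> 'l lseq" is seq_scale
  by (rule ell2_seq_scale)

lift_definition site :: "complex ^ ('l::finite) \<Rightarrow> 'l lseq" is first_site
proof -
  fix v :: "complex ^ 'l"
  have "summable (\<lambda>n. (norm (first_site v n))\<^sup>2)"
    by (rule summable_finite[of "{1}"]) (auto simp: first_site_def)
  then show "first_site v \<in> ell2" by (simp add: ell2_def first_site_def)
qed

definition first :: "('l::finite) lseq \<Rightarrow> complex ^ 'l" where
  "first f = Rep_lseq f 1"

lemma Rep_lseq_0 [simp]: "Rep_lseq f 0 = 0"
  using Rep_lseq[of f] by (simp add: ell2_def)

lemma first_simps [simp]:
  "first 0 = 0" "first (f + g) = first f + first g" "first (f - g) = first f - first g"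
  "first (- f) = - first f" "first (r *\<^sub>R f) = r *\<^sub>R first f"
  "first (cscale c f) = c *s first f" "first (site v) = v"
  by (simp_all add: first_def zero_lseq.rep_eq plus_lseq.rep_eq minus_lseq.rep_eq uminus_lseq.rep_eq
      scaleR_lseq.rep_eq cscale.rep_eq site.rep_eq first_site_def seq_scale_def)

lemma site_simps [simp]:
  "site 0 = 0" "site (v + w) = site v + site w" "site (v - w) = site v - site w"
  "site (c *s v) = cscale c (site v)" "site (- v) = - site v" "site (r *\<^sub>R v) = r *\<^sub>R site v"
  by (transfer; auto simp: first_site_def fun_eq_iff seq_scale_def)+

lemma Rep_cscale [simp]: "Rep_lseq (cscale c f) n $ i = c * Rep_lseq f n $ i"
  by (simp add: cscale.rep_eq seq_scale_def)

lemma lseq_eqI: "(\<And>n i. Rep_lseq f n $ i = Rep_lseq g n $ i) \<Longrightarrow> f = g"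
  by (simp add: fun_eq_iff vec_eq_iff flip: Rep_lseq_inject)

lemma cscale_simps [simp]:
  "cscale c 0 = 0" "cscale 0 f = 0" "cscale 1 f = f" "cscale c (cscale d f) = cscale (c * d) f"
  "cscale (- c) f = - cscale c f" "cscale c (- f) = - cscale c f"
  "cscale (of_real r) f = r *\<^sub>R f" "cscale c (r *\<^sub>R f) = r *\<^sub>R cscale c f"
  by (rule lseq_eqI; simp add: zero_lseq.rep_eq uminus_lseq.rep_eq scaleR_lseq.rep_eq
      complex_eq_iff algebra_simps)+

lemma cscale_distrib:
  "cscale c (f + g) = cscale c f + cscale c g" "cscale c (f - g) = cscale c f - cscale c g"
  "cscale (c + d) f = cscale c f + cscale d f" "cscale (c - d) f = cscale c f - cscale d f"
  by (rule lseq_eqI; simp add: plus_lseq.rep_eq minus_lseq.rep_eq algebra_simps)+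

lemma linear_cscale: "linear (cscale c)"
  by (rule linearI) (simp_all add: cscale_distrib)

lemma linear_first: "linear first"
  by (rule linearI) simp_all

lemma norm_cscale [simp]: "norm (cscale c f) = norm c * norm f"
proof -
  have "(norm (cscale c f))\<^sup>2 = (norm c * norm f)\<^sup>2"
    unfolding power2_norm_lseq power_mult_distrib
    by (simp add: cscale.rep_eq seq_scale_def norm_vector_scale power_mult_distrib suminf_mult summable_norm_lseq)
  then show ?thesis by simp
qed

lemma inner_site: "inner f (site v) = inner (first f) v"
proof -
  have "inner f (site v) = (\<Sum>n\<in>{1}. inner (Rep_lseq f n) (first_site v n))"
    unfolding inner_lseq.rep_eq site.rep_eq by (rule suminf_finite) (auto simp: first_site_def)
  then show ?thesis by (simp add: first_def first_site_def)
qed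

lemma inner_site': "inner (site v) f = inner v (first f)"
  using inner_site[of f v] by (simp add: inner_commute)

lemma norm_site [simp]: "norm (site v) = norm v"
  using inner_site[of "site v" v] by (simp add: norm_eq_sqrt_inner)

lemma norm_first_le: "norm (first f) \<le> norm f"
  unfolding first_def by (rule norm_lseq_nth_le)

lemma inner_vector_scale_ii: "inner (\<i> *s x) y = - inner x (\<i> *s y)" for x y :: "complex ^ 'n"
  by (simp add: inner_vec_def inner_complex_def sum_negf[symmetric])

text \<open>
  The skew-symmetry of multiplication by \<open>\<i>\<close> is the part of sesquilinearity that a real inner product
  retains.
\<close>

lemma inner_cscale_ii: "inner (cscale \<i> f) g = - inner f (cscale \<i> g)"
proof -
  have "inner (cscale \<i> f) g = (\<Sum>n. - inner (Rep_lseq f n) (\<i> *s Rep_lseq g n))"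
    by (simp add: inner_lseq.rep_eq cscale.rep_eq seq_scale_def inner_vector_scale_ii)
  also have "\<dots> = - inner f (cscale \<i> g)"
    using summable_inner_ell2[OF Rep_lseq[of f] Rep_lseq[of "cscale \<i> g"]]
    by (simp add: inner_lseq.rep_eq suminf_minus cscale.rep_eq seq_scale_def)
  finally show ?thesis .
qed

section \<open>Block Jacobi matrices as symmetric operators\<close>

lemma norm_matrix_vector_mult_le:
  fixes M :: "complex ^ 'n ^ 'm"
  assumes "\<And>i j. norm (M $ i $ j) \<le> b"
  shows "norm (M *v x) \<le> real CARD('m) * (real CARD('n) * b) * norm x"
proof -
  have "norm (M *v x) \<le> (\<Sum>i\<in>UNIV. norm ((M *v x) $ i))"
    unfolding norm_vec_def by (rule L2_set_le_sum) simp
  also have "\<dots> \<le> (\<Sum>i\<in>(UNIV::'m set). \<Sum>j\<in>(UNIV::'n set). b * norm x)"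
  proof (rule sum_mono)
    fix i
    have "norm ((M *v x) $ i) \<le> (\<Sum>j\<in>UNIV. norm (M $ i $ j * x $ j))"
      unfolding matrix_vector_mult_def by (simp add: norm_sum)
    also have "\<dots> \<le> (\<Sum>j\<in>(UNIV::'n set). b * norm x)"
      unfolding norm_mult
      by (intro sum_mono mult_mono assms Finite_Cartesian_Product.norm_nth_le norm_ge_zero
          order_trans[OF norm_ge_zero assms])
    finally show "norm ((M *v x) $ i) \<le> (\<Sum>j\<in>(UNIV::'n set). b * norm x)" .
  qed
  finally show ?thesis by simp
qed

lemma inner_ctranspose: "inner (ctranspose M *v x) y = inner x (M *v y)"
  for M :: "complex ^ 'n ^ 'm"
proof -
  have *: "inner (cnj a * b) c = inner b (a * c)" for a b c :: complex
    by (simp add: inner_complex_def algebra_simps)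
  have "inner (ctranspose M *v x) y = (\<Sum>i\<in>UNIV. \<Sum>j\<in>UNIV. inner (x $ j) (M $ j $ i * y $ i))"
    by (simp add: inner_vec_def matrix_vector_mult_def ctranspose_def map_matrix_def transpose_def
        inner_sum_left *)
  also have "\<dots> = inner x (M *v y)"
    by (subst sum.swap) (simp add: inner_vec_def matrix_vector_mult_def inner_sum_right)
  finally show ?thesis .
qed

lemma inner_ctranspose': "inner (M *v y) x = inner y (ctranspose M *v x)"
  for M :: "complex ^ 'n ^ 'm"
  using inner_ctranspose[of M x y] by (simp add: inner_commute)

lemma ell2_dominated:
  assumes "h 0 = 0" "\<And>n. norm (h n) \<le> C * norm (f (k n))" "summable (\<lambda>n. (norm (f (k n)))\<^sup>2)"
  shows "h \<in> ell2"
proof -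
  have "summable (\<lambda>n. (norm (h n))\<^sup>2)"
  proof (rule summable_comparison_test')
    show "summable (\<lambda>n. C\<^sup>2 * (norm (f (k n)))\<^sup>2)" using assms(3) by (rule summable_mult)
    show "norm ((norm (h n))\<^sup>2) \<le> C\<^sup>2 * (norm (f (k n)))\<^sup>2" for n
      using power_mono[OF assms(2)[of n], of 2] by (simp add: power_mult_distrib)
  qed
  then show ?thesis using assms(1) by (simp add: ell2_def)
qed

locale block_jacobi =
  fixes A B :: "nat \<Rightarrow> complex ^ 'l ^ 'l"
  assumes params: "jacobi_params A B"
begin

definition lower where "lower f n = (if n = 0 then 0 else ctranspose (A (n - 1)) *v f (n - 1))"
definition diag where "diag f n = (if n = 0 then 0 else B n *v f n)"
definition upper where "upper f n = (if n = 0 then 0 else A n *v f (n + 1))"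

lemma jacobi_op_split: "jacobi_op A B f = lower f + diag f + upper f"
  by (auto simp: jacobi_op_def lower_def diag_def upper_def)

lemma split_ell2:
  assumes f: "f \<in> ell2"
  shows "lower f \<in> ell2" "diag f \<in> ell2" "upper f \<in> ell2"
proof -
  obtain b where "\<forall>x\<in>(\<lambda>n. norm (A n) + norm (B n)) ` {1..}. x \<le> b"
    using params by (auto simp: jacobi_params_def bdd_above_def)
  then have b: "norm (A n) + norm (B n) \<le> b" if "n \<ge> 1" for n
    using that by auto
  have entry: "norm (M $ i $ j) \<le> norm M" for M :: "complex ^ 'l ^ 'l" and i j
    by (rule order_trans[OF Finite_Cartesian_Product.norm_nth_le Finite_Cartesian_Product.norm_nth_le])
  have AB: "norm (A n $ i $ j) \<le> b" "norm (B n $ i $ j) \<le> b" if "n \<ge> 1" for n i j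
    using b[OF that] entry[of "A n" i j] entry[of "B n" i j] by (smt (verit) norm_ge_zero)+
  have At: "norm (ctranspose (A n) $ i $ j) \<le> b" if "n \<ge> 1" for n i j
    using AB(1)[OF that] by (simp add: ctranspose_def map_matrix_def transpose_def)
  define C where "C = real CARD('l) * (real CARD('l) * b)"
  have bound: "norm (M *v x) \<le> C * norm x"
    if "\<And>i j. norm (M $ i $ j) \<le> b" for M :: "complex ^ 'l ^ 'l" and x
    using norm_matrix_vector_mult_le[OF that] by (simp add: C_def)
  have "0 \<le> b" using b[of 1] norm_ge_zero[of "A 1"] norm_ge_zero[of "B 1"] by linarith
  then have C: "0 \<le> C" by (simp add: C_def)
  have f0: "f 0 = 0" and sf: "summable (\<lambda>n. (norm (f n))\<^sup>2)" using f by (auto simp: ell2_def)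
  have sf': "summable (\<lambda>n. (norm (f (n - 1)))\<^sup>2)" "summable (\<lambda>n. (norm (f (n + 1)))\<^sup>2)"
    using sf summable_Suc_iff[of "\<lambda>n. (norm (f (n - 1)))\<^sup>2"] summable_Suc_iff[of "\<lambda>n. (norm (f n))\<^sup>2"]
    by simp_all
  have nl: "norm (lower f n) \<le> C * norm (f (n - 1))" for n
    using bound[OF At, of "n - 1" "f (n - 1)"] C f0
    by (cases "n - 1 = 0") (auto simp: lower_def)
  show "lower f \<in> ell2"
    by (rule ell2_dominated[where k="\<lambda>n. n - 1", OF _ nl sf'(1)]) (simp add: lower_def)
  show "diag f \<in> ell2"
    by (rule ell2_dominated[where k="\<lambda>n. n" and C=C, OF _ _ sf])
      (use bound[OF AB(2)] C in \<open>auto simp: diag_def\<close>)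
  show "upper f \<in> ell2"
    by (rule ell2_dominated[where k="\<lambda>n. n + 1" and C=C, OF _ _ sf'(2)])
      (use bound[OF AB(1)] C in \<open>auto simp: upper_def\<close>)
qed

lemma jacobi_op_ell2: "f \<in> ell2 \<Longrightarrow> jacobi_op A B f \<in> ell2"
  unfolding jacobi_op_split by (intro ell2_add split_ell2)

text \<open>
  The two off-diagonal parts are adjoint to each other: the sums agree after a shift of the index, and
  the boundary term vanishes because both sequences are \<open>0\<close> at \<open>0\<close>.
\<close>

lemma lower_upper_adjoint:
  assumes "f \<in> ell2" "g \<in> ell2"
  shows "(\<Sum>n. inner (lower f n) (g n)) = (\<Sum>n. inner (f n) (upper g n))"
proof -
  have f0: "f 0 = 0" using assms by (simp add: ell2_def)
  have "(\<Sum>n. inner (lower f (Suc n)) (g (Suc n))) = (\<Sum>n. inner (lower f n) (g n))"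
    using suminf_split_head[OF summable_inner_ell2[OF split_ell2(1)[OF assms(1)] assms(2)]]
    by (simp add: lower_def)
  moreover have "inner (lower f (Suc n)) (g (Suc n)) = inner (f n) (upper g n)" for n
    using f0 by (cases n) (simp_all add: lower_def upper_def inner_ctranspose)
  ultimately show ?thesis by simp
qed

definition J :: "'l lseq \<Rightarrow> 'l lseq" where
  "J f = Abs_lseq (jacobi_op A B (Rep_lseq f))"

lemma Rep_J: "Rep_lseq (J f) = jacobi_op A B (Rep_lseq f)"
  unfolding J_def by (rule Abs_lseq_inverse) (rule jacobi_op_ell2[OF Rep_lseq])

lemma J_cscale: "J (cscale c f) = cscale c (J f)"
  unfolding Rep_lseq_inject[symmetric] Rep_J cscale.rep_eq
  by (rule ext) (simp add: jacobi_op_def seq_scale_def vector_scalar_commute)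

lemma J_add: "J (f + g) = J f + J g"
  unfolding Rep_lseq_inject[symmetric] Rep_J plus_lseq.rep_eq
  by (auto simp: jacobi_op_def fun_eq_iff matrix_vector_right_distrib)

lemma J_scaleR: "J (r *\<^sub>R f) = r *\<^sub>R J f"
  using J_cscale[of "of_real r" f] by simp

lemma linear_J: "linear J"
  by (rule linearI) (simp_all add: J_add J_scaleR)

lemma J_symmetric: "inner (J f) g = inner f (J g)"
proof -
  let ?f = "Rep_lseq f" and ?g = "Rep_lseq g"
  note m = Rep_lseq[of f] Rep_lseq[of g]
  note e = split_ell2[OF m(1)] split_ell2[OF m(2)]
  have "(\<Sum>n. inner (diag ?f n) (?g n)) = (\<Sum>n. inner (?f n) (diag ?g n))"
  proof (rule suminf_cong)
    fix n show "inner (diag ?f n) (?g n) = inner (?f n) (diag ?g n)"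
      using params by (cases n) (auto simp: diag_def jacobi_params_def inner_ctranspose' simp flip: One_nat_def)
  qed
  moreover have "(\<Sum>n. inner (upper ?f n) (?g n)) = (\<Sum>n. inner (?f n) (lower ?g n))"
    using lower_upper_adjoint[OF m(2,1)] by (simp add: inner_commute)
  ultimately show ?thesis
    using lower_upper_adjoint[OF m] e m unfolding inner_lseq.rep_eq Rep_J jacobi_op_split
    by (simp add: inner_add_left inner_add_right suminf_add[symmetric] summable_inner_ell2 summable_add)
qed

text \<open>
  Transport of the resolvent set along the type copy; a bound on the inverse becomes a lower bound on the
  operator.
\<close>

lemma resolvent_set_iff:
  "z \<in> resolvent_set (jacobi_op A B) \<longleftrightarrow> boundedly_invertible (\<lambda>f. J f - cscale z f)"
proof -
  define T where "T = (\<lambda>f. J f - cscale z f)"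
  define t where "t = (\<lambda>f. jacobi_op A B f - seq_scale z f)"
  have Rt: "Rep_lseq (T f) = t (Rep_lseq f)" for f
    by (simp add: T_def t_def minus_lseq.rep_eq cscale.rep_eq Rep_J)
  have bR: "bij_betw Rep_lseq UNIV ell2"
    using type_definition.Rep_range[OF type_definition_lseq] by (simp add: bij_betw_def inj_on_def Rep_lseq_inject)
  have "bij T \<longleftrightarrow> bij_betw (Rep_lseq \<circ> T) UNIV ell2"
    using bij_betw_comp_iff2[OF bR, of T UNIV] by (simp)
  also have "Rep_lseq \<circ> T = t \<circ> Rep_lseq" using Rt by auto
  also have "bij_betw (t \<circ> Rep_lseq) UNIV ell2 \<longleftrightarrow> bij_betw t ell2 ell2"
    using bij_betw_comp_iff[OF bR, of t ell2] by simp
  finally have 1: "bij T \<longleftrightarrow> bij_betw t ell2 ell2" .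
  have "(\<exists>C. \<forall>f\<in>ell2. ell2_norm f \<le> C * ell2_norm (t f)) \<longleftrightarrow> (\<exists>C. \<forall>f. norm f \<le> C * norm (T f))"
    unfolding norm_lseq_eq Rt by (metis Rep_lseq Abs_lseq_inverse)
  also have "\<dots> \<longleftrightarrow> (\<exists>c>0. \<forall>f. c * norm f \<le> norm (T f))"
  proof
    assume "\<exists>C. \<forall>f. norm f \<le> C * norm (T f)"
    then obtain C where C: "\<And>f. norm f \<le> C * norm (T f)" by blast
    \<comment> \<open>\<open>C\<close> need not be positive\<close>
    have "norm f \<le> (\<bar>C\<bar> + 1) * norm (T f)" for f
      using C[of f] by (smt (verit) mult_right_mono norm_ge_zero)
    then show "\<exists>c>0. \<forall>f. c * norm f \<le> norm (T f)"
      by (intro exI[of _ "1 / (\<bar>C\<bar> + 1)"]) (auto simp: field_simps)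
  next
    assume "\<exists>c>0. \<forall>f. c * norm f \<le> norm (T f)"
    then obtain c where "c > 0" "\<And>f. c * norm f \<le> norm (T f)" by blast
    then show "\<exists>C. \<forall>f. norm f \<le> C * norm (T f)"
      by (intro exI[of _ "1/c"]) (auto simp: field_simps)
  qed
  finally show ?thesis
    using 1 unfolding resolvent_set_def boundedly_invertible_def T_def t_def by simp
qed

lemma resolvent_eqI:
  assumes z: "z \<in> resolvent_set (jacobi_op A B)" and f: "J f - cscale z f = g"
  shows "resolvent (jacobi_op A B) z (Rep_lseq g) = Rep_lseq f"
  unfolding resolvent_def
proof (rule the_inv_into_f_eq)
  show "inj_on (\<lambda>f. jacobi_op A B f - seq_scale z f) ell2"
    using z by (auto simp: resolvent_set_def bij_betw_def)
  show "jacobi_op A B (Rep_lseq f) - seq_scale z (Rep_lseq f) = Rep_lseq g"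
    by (simp add: f[symmetric] minus_lseq.rep_eq cscale.rep_eq Rep_J)
qed (rule Rep_lseq)

text \<open>
  The three-term recursion determines an eigenvector from its first entry, since all \<open>A n\<close> with \<open>n \<ge> 1\<close>
  are invertible.
\<close>

lemma eigenvector_first_nonzero:
  assumes eq: "J f = cscale z f" and "first f = 0"
  shows "f = 0"
proof -
  have rec: "jacobi_op A B (Rep_lseq f) n = z *s Rep_lseq f n" for n
    using arg_cong[OF eq, of "\<lambda>g. Rep_lseq g n"] by (simp add: Rep_J cscale.rep_eq seq_scale_def)
  have "Rep_lseq f n = 0 \<and> Rep_lseq f (Suc n) = 0" for n
  proof (induction n)
    case 0
    show ?case using assms(2) by (simp add: first_def)
  next
    case (Suc n)
    have "A (Suc n) *v Rep_lseq f (Suc (Suc n)) = 0"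
      using rec[of "Suc n"] Suc by (simp add: jacobi_op_def)
    moreover have "invertible (A (Suc n))"
      using params by (simp add: jacobi_params_def invertible_det_nz)
    ultimately have "Rep_lseq f (Suc (Suc n)) = 0"
      by (metis invertible_def matrix_vector_mul_assoc matrix_vector_mul_lid matrix_vector_mult_0_right)
    then show ?case using Suc by simp
  qed
  then show "f = 0"
    unfolding Rep_lseq_inject[symmetric] zero_lseq.rep_eq by (simp add: fun_eq_iff)
qed

end

section \<open>Bounded invertibility of the damped operator\<close>

context block_jacobi
begin

text \<open>
  This is \<open>J - z\<close> with \<open>B 1\<close> replaced by \<open>B 1 + \<i>\<close>.  The perturbation has finite rank and moves the
  eigenvalues of \<open>J\<close> off the real axis, so that the operator stays invertible at a real eigenvalue.
\<close>

definition damped :: "complex \<Rightarrow> 'l lseq \<Rightarrow> 'l lseq" where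
  "damped z f = J f - cscale z f + cscale \<i> (site (first f))"

lemma linear_shifted_J: "linear (\<lambda>f. J f - cscale z f)"
  by (rule linear_compose_sub[OF linear_J linear_cscale])

lemma damped_add: "damped z (f + g) = damped z f + damped z g"
  by (simp add: damped_def J_add cscale_distrib algebra_simps)

lemma damped_cscale: "damped z (cscale c f) = cscale c (damped z f)"
  by (simp add: damped_def J_cscale cscale_distrib mult.commute)

lemma linear_damped: "linear (damped z)"
  using damped_add damped_cscale[of z "of_real _"] by (intro linearI) simp_all

lemma damped_shift: "damped z f + cscale (z - w) f = damped w f"
  by (simp add: damped_def cscale_distrib)

text \<open>
  For real \<open>x\<close> the operator \<open>J - x\<close> is symmetric, so that the imaginary part of the complex inner product of \<open>f\<close> with
  \<open>damped x f\<close> only sees the perturbation.  The real inner product with \<open>\<i> f\<close> computes this imaginary part.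
\<close>

lemma damped_dissipative: "(norm (first f))\<^sup>2 \<le> norm f * norm (damped (of_real x) f)"
proof -
  have ii: "inner (cscale \<i> f) f = 0"
    using inner_cscale_ii[of f f] by (simp add: inner_commute)
  have "inner (cscale \<i> f) (J f) = - inner (cscale \<i> f) (J f)"
    using inner_cscale_ii[of f "J f"] J_symmetric[of f "cscale \<i> f"]
    by (simp add: J_cscale inner_commute)
  moreover have "inner (cscale \<i> f) (cscale \<i> (site (first f))) = (norm (first f))\<^sup>2"
    using inner_cscale_ii[of f "cscale \<i> (site (first f))"]
    by (simp add: inner_site power2_norm_eq_inner)
  ultimately have "inner (cscale \<i> f) (damped (of_real x) f) = (norm (first f))\<^sup>2"
    by (simp add: damped_def inner_add_right inner_diff_right ii)
  then show ?thesis
    using norm_cauchy_schwarz[of "cscale \<i> f" "damped (of_real x) f"] by simp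
qed

lemma damped_inj: "damped (of_real x) f = 0 \<Longrightarrow> f = 0"
  using damped_dissipative[of f x] eigenvector_first_nonzero[of f "of_real x"]
  by (simp add: damped_def)

text \<open>
  An eigenvector is determined linearly by its first entry, and a linear map on a finite-dimensional
  space is bounded.
\<close>

lemma eigenvectors_bounded_by_first:
  "\<exists>K>0. \<forall>e. J e = x *\<^sub>R e \<longrightarrow> norm e \<le> K * norm (first e)"
proof -
  define E where "E = {e. J e = x *\<^sub>R e}"
  have E: "subspace E"
    by (auto simp: E_def subspace_def J_add J_scaleR linear_0[OF linear_J] algebra_simps)
  have "inj_on first E"
  proof (rule inj_onI)
    fix e e' assume *: "e \<in> E" "e' \<in> E" "first e = first e'"
    then have "e - e' \<in> E" using E by (simp add: subspace_diff)
    then have "e - e' = 0"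
      using * by (intro eigenvector_first_nonzero[of _ "of_real x"]) (simp_all add: E_def)
    then show "e = e'" by simp
  qed
  then obtain g where g: "linear g" "\<forall>e\<in>E. g (first e) = e"
    using linear_exists_left_inverse_on[OF linear_first E] by blast
  obtain K where K: "K > 0" "\<And>v. norm (g v) \<le> K * norm v"
    using linear_bounded_pos[OF g(1)] by blast
  have "norm e \<le> K * norm (first e)" if "J e = x *\<^sub>R e" for e
    using K(2)[of "first e"] g(2) that by (simp add: E_def)
  then show ?thesis using K(1) by blast
qed

lemma arith_geo_mean_squared: "4 * (a * b) \<le> (a + b)\<^sup>2" for a b :: real
  using zero_le_power2[of "a - b"] by (simp add: power2_sum power2_diff)

text \<open>
  Let \<open>f - s\<close> be the kernel component of \<open>f\<close>.  It is controlled by its first entry, and \<open>s\<close> by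
  \<open>J f - x0 f\<close>, so \<open>f\<close> is controlled by its first entry together with \<open>J f - x0 f\<close>.  The first entry is in
  turn at most the geometric mean of the norms of \<open>f\<close> and \<open>damped x f\<close>, which can be absorbed.
\<close>

lemma damped_bounded_below:
  assumes C: "C \<ge> 0"
    and sol: "\<And>f. \<exists>s. J s - x0 *\<^sub>R s = J f - x0 *\<^sub>R f \<and> norm s \<le> C * norm (J f - x0 *\<^sub>R f)"
  shows "\<exists>c>0. \<exists>d>0. \<forall>x. \<bar>x - x0\<bar> \<le> d \<longrightarrow> (\<forall>f. c * norm f \<le> norm (damped (of_real x) f))"
proof -
  obtain K where K: "K > 0" "\<And>e. J e = x0 *\<^sub>R e \<Longrightarrow> norm e \<le> K * norm (first e)"
    using eigenvectors_bounded_by_first by blast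
  define L where "L = (K + 1) * C"
  have L: "L \<ge> 0" using C K by (simp add: L_def)
  have 1: "norm f \<le> K * norm (first f) + L * norm (J f - x0 *\<^sub>R f)" for f
  proof -
    obtain s where s: "J s - x0 *\<^sub>R s = J f - x0 *\<^sub>R f" "norm s \<le> C * norm (J f - x0 *\<^sub>R f)"
      using sol by blast
    have "norm (f - s) \<le> K * norm (first (f - s))"
      using s(1) by (intro K) (simp add: linear_diff[OF linear_J] algebra_simps)
    also have "norm (first (f - s)) \<le> norm (first f) + norm s"
      using norm_triangle_ineq4[of "first f" "first s"] norm_first_le[of s] by simp
    finally have "norm (f - s) \<le> K * norm (first f) + K * norm s"
      using K(1) by (simp add: algebra_simps)
    moreover have "norm f \<le> norm (f - s) + norm s" using norm_triangle_ineq[of "f - s" s] by simp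
    ultimately have "norm f \<le> K * norm (first f) + (K + 1) * norm s" by (simp add: algebra_simps)
    also have "(K + 1) * norm s \<le> (K + 1) * (C * norm (J f - x0 *\<^sub>R f))"
      using K(1) by (intro mult_left_mono s) auto
    finally show ?thesis by (simp add: L_def mult.assoc)
  qed
  define M where "M = (K + L)\<^sup>2 + L"
  have M: "M > 0" using K L by (simp add: M_def add_pos_nonneg)
  \<comment> \<open>the shift by \<open>x - x0\<close> may use up a quarter of \<open>norm f\<close>, the first entry another quarter\<close>
  have "1 / (2 * M) * norm f \<le> norm (damped (of_real x) f)"
    if x: "\<bar>x - x0\<bar> \<le> 1 / (4 * (L + 1))" for x f
  proof -
    define a b u where "a = norm f" "b = norm (damped (of_real x) f)" "u = norm (first f)"
    have nn: "a \<ge> 0" "b \<ge> 0" "u \<ge> 0" by (auto simp: a_b_u_def)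
    have u: "u\<^sup>2 \<le> a * b" using damped_dissipative[of f x] by (simp add: a_b_u_def)
    have "J f - x0 *\<^sub>R f = damped (of_real x) f + (x - x0) *\<^sub>R f - cscale \<i> (site (first f))"
      by (simp add: damped_def algebra_simps)
    then have "norm (J f - x0 *\<^sub>R f) \<le> b + \<bar>x - x0\<bar> * a + u"
      using norm_triangle_ineq4[of "damped (of_real x) f + (x - x0) *\<^sub>R f" "cscale \<i> (site (first f))"]
        norm_triangle_ineq[of "damped (of_real x) f" "(x - x0) *\<^sub>R f"]
      by (simp add: a_b_u_def)
    then have "L * norm (J f - x0 *\<^sub>R f) \<le> L * (b + \<bar>x - x0\<bar> * a + u)"
      using L by (rule mult_left_mono)
    then have "a \<le> K * u + L * (b + \<bar>x - x0\<bar> * a + u)" using 1[of f] by (simp add: a_b_u_def)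
    moreover have "L * (\<bar>x - x0\<bar> * a) \<le> a / 4"
    proof -
      have "L * \<bar>x - x0\<bar> \<le> L * (1 / (4 * (L + 1)))" using x L by (rule mult_left_mono)
      also have "\<dots> \<le> 1 / 4" using L by (simp add: field_simps)
      finally show ?thesis using mult_right_mono[OF _ nn(1), of "L * \<bar>x - x0\<bar>" "1/4"] by simp
    qed
    ultimately have 2: "3 / 4 * a \<le> (K + L) * u + L * b" by (simp add: algebra_simps)
    have 3: "(K + L) * u \<le> a / 4 + (K + L)\<^sup>2 * b"
    proof (rule power2_le_imp_le)
      have "((K + L) * u)\<^sup>2 \<le> (K + L)\<^sup>2 * (a * b)"
        unfolding power_mult_distrib using u by (rule mult_left_mono) simp
      also have "\<dots> \<le> (a / 4 + (K + L)\<^sup>2 * b)\<^sup>2"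
        using arith_geo_mean_squared[of "a / 4" "(K + L)\<^sup>2 * b"] by (simp add: mult.left_commute)
      finally show "((K + L) * u)\<^sup>2 \<le> (a / 4 + (K + L)\<^sup>2 * b)\<^sup>2" .
    qed (use nn in simp)
    have "a / 2 \<le> M * b" using 2 3 by (simp add: M_def algebra_simps)
    then show ?thesis using M by (simp add: a_b_u_def field_simps)
  qed
  then show ?thesis
    using M L by (intro exI[of _ "1 / (2 * M)"] conjI exI[of _ "1 / (4 * (L + 1))"]) auto
qed

text \<open>
  Since the perturbation only sees the first entry, solving \<open>damped x f = h\<close> reduces to an equation for
  \<open>first f\<close> in a finite-dimensional space, where injectivity implies surjectivity.  Injectivity at real
  points follows from the dissipation estimate.
\<close>

lemma damped_bij:
  assumes x: "of_real x \<in> resolvent_set (jacobi_op A B)"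
  shows "bij (damped (of_real x))"
proof -
  define T where "T = (\<lambda>f. J f - cscale (of_real x) f)"
  define R where "R = inv T"
  have T: "bij T" using x unfolding resolvent_set_iff boundedly_invertible_def T_def by blast
  have linT: "linear T" unfolding T_def by (rule linear_shifted_J)
  have TR: "T (R f) = f" and RT: "R (T f) = f" for f
    using T by (auto simp: R_def bij_is_surj surj_f_inv_f bij_is_inj)
  have R_add: "R (f + g) = R f + R g" for f g by (metis TR RT linear_add[OF linT])
  have R_scale: "R (r *\<^sub>R f) = r *\<^sub>R R f" for r f by (metis TR RT linear_scale[OF linT])
  have R_cscale: "R (cscale c f) = cscale c (R f)" for c f
  proof -
    have "T (cscale c (R f)) = cscale c (T (R f))"
      by (simp add: T_def J_cscale cscale_distrib scaleR_conv_of_real)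
    then show ?thesis by (metis TR RT)
  qed
  have dT: "damped (of_real x) f = T f + cscale \<i> (site (first f))" for f
    by (simp add: damped_def T_def)
  \<comment> \<open>the equation for the first coordinate alone\<close>
  define N where "N v = v + \<i> *s first (R (site v))" for v
  have N_add: "N (v + w) = N v + N w" and N_scale: "N (r *\<^sub>R v) = r *\<^sub>R N v" for v w r
    by (simp_all add: N_def R_add R_scale vec_eq_iff algebra_simps)
  have linN: "linear N" by (rule linearI) (simp_all add: N_add N_scale)
  have "v = 0" if "N v = 0" for v
  proof -
    define f where "f = - cscale \<i> (R (site v))"
    have v: "first f = v" 
      using that minus_unique[of "\<i> *s first (R (site v))" v] by (simp add: f_def N_def add.commute)
    have "damped (of_real x) f = 0"
      unfolding dT v by (simp add: f_def linear_neg[OF linT] TR flip: R_cscale)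
    then have "f = 0" by (rule damped_inj)
    then show "v = 0" using v by simp
  qed
  then have "inj N" using linear_injective_0[OF linN] by simp
  then have surjN: "surj N" using linear_injective_imp_surjective[OF linN] by simp
  have "\<exists>f. damped (of_real x) f = h" for h
  proof -
    obtain v where v: "N v = first (R h)" using surjN unfolding surj_def by metis
    define f where "f = R h - cscale \<i> (R (site v))"
    have "first f = v" using v by (simp add: f_def N_def algebra_simps)
    then have "damped (of_real x) f = h"
      unfolding dT by (simp add: f_def linear_diff[OF linT] TR flip: R_cscale)
    then show ?thesis by blast
  qed
  then have "surj (damped (of_real x))" unfolding surj_def by metis
  moreover have "inj (damped (of_real x))"
    using linear_injective_0[OF linear_damped] damped_inj by blast
  ultimately show ?thesis by (simp add: bij_def)
qed


lemma boundedly_invertible_cscale_shift: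
  assumes T: "linear T" "bij T" "\<And>f. c * norm f \<le> norm (T f)" and t: "norm t < c"
  shows "bij (\<lambda>f. T f - cscale t f)" "(c - norm t) * norm f \<le> norm (T f - cscale t f)"
proof -
  have "bij (\<lambda>f. T f + cscale (- t) f)"
    by (rule bij_bounded_perturbation[OF T linear_cscale _ _ t]) simp_all
  then show "bij (\<lambda>f. T f - cscale t f)" by simp
  show "(c - norm t) * norm f \<le> norm (T f - cscale t f)"
    using T(3)[of f] norm_triangle_ineq2[of "T f" "cscale t f"] by (simp add: algebra_simps)
qed

lemma resolvent_set_open: "open (resolvent_set (jacobi_op A B))"
  unfolding open_contains_ball
proof
  fix z assume "z \<in> resolvent_set (jacobi_op A B)"
  then obtain c where bij: "bij (\<lambda>f. J f - cscale z f)"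
    and c: "c > 0" "\<And>f. c * norm f \<le> norm (J f - cscale z f)"
    unfolding resolvent_set_iff boundedly_invertible_def by blast
  have "w \<in> resolvent_set (jacobi_op A B)" if "w \<in> ball z c" for w
  proof -
    have t: "norm (w - z) < c" using that by (simp add: dist_norm norm_minus_commute)
    note shift = boundedly_invertible_cscale_shift[OF linear_shifted_J bij c(2) t]
    have eq: "J f - cscale z f - cscale (w - z) f = J f - cscale w f" for f
      by (simp add: cscale_distrib)
    show ?thesis
      using shift[unfolded eq] t unfolding resolvent_set_iff boundedly_invertible_def
      by (intro conjI exI[of _ "c - norm (w - z)"]) auto
  qed
  then show "\<exists>e>0. ball z e \<subseteq> resolvent_set (jacobi_op A B)"
    using c(1) by blast
qed

lemma resolvent_set_punctured_nhd:
  assumes "z0 \<notin> ess_spectrum (jacobi_op A B)"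
  obtains e where "e > 0" "\<And>z. z \<in> ball z0 e \<Longrightarrow> z \<noteq> z0 \<Longrightarrow> z \<in> resolvent_set (jacobi_op A B)"
proof (cases "z0 \<in> resolvent_set (jacobi_op A B)")
  case True
  then obtain e where "e > 0" "ball z0 e \<subseteq> resolvent_set (jacobi_op A B)"
    using resolvent_set_open openE by blast
  then show ?thesis using that by blast
next
  case False
  then have "z0 isolated_in spectrum (jacobi_op A B)"
    using assms by (simp add: ess_spectrum_def spectrum_def discrete_spectrum_def)
  then obtain U where U: "open U" "z0 \<in> U" "U \<inter> spectrum (jacobi_op A B) = {z0}"
    unfolding isolated_in_def by auto
  then obtain e where e: "e > 0" "ball z0 e \<subseteq> U" using openE by blast
  show ?thesis
  proof (rule that[OF e(1)])
    fix z assume "z \<in> ball z0 e" "z \<noteq> z0"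
    then have "z \<notin> spectrum (jacobi_op A B)" using e(2) U(3) by blast
    then show "z \<in> resolvent_set (jacobi_op A B)" by (simp add: spectrum_def)
  qed
qed

text \<open>
  At a nearby real point \<open>x\<close> of the resolvent set the operator \<open>damped x\<close> is bijective, and its lower bound
  is uniform in \<open>x\<close>.  Hence a point closer to \<open>x0\<close> than this bound can be moved to \<open>x0\<close> without losing
  bijectivity.
\<close>

lemma damped_boundedly_invertible:
  assumes "of_real x0 \<notin> ess_spectrum (jacobi_op A B)"
  shows "boundedly_invertible (damped (of_real x0))"
proof -
  obtain e where e: "e > 0"
    "\<And>z. z \<in> ball (of_real x0) e \<Longrightarrow> z \<noteq> of_real x0 \<Longrightarrow> z \<in> resolvent_set (jacobi_op A B)"
    using resolvent_set_punctured_nhd[OF assms] by blast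
  have e': "of_real x \<in> resolvent_set (jacobi_op A B)" if "x \<noteq> x0" "\<bar>x - x0\<bar> < e" for x
    using that by (intro e(2)) (auto simp: dist_norm abs_minus_commute simp flip: of_real_diff)
  define D where "D = (\<lambda>f. J f - x0 *\<^sub>R f)"
  have linD: "linear D" using linear_shifted_J[of "of_real x0"] by (simp add: D_def)
  have symD: "inner (D f) g = inner f (D g)" for f g
    by (simp add: D_def inner_diff_left inner_diff_right J_symmetric)
  have inv: "boundedly_invertible (\<lambda>f. D f - x *\<^sub>R f)" if "x \<noteq> 0" "\<bar>x\<bar> < 2 * (e / 2)" for x
  proof -
    have "D f - x *\<^sub>R f = J f - cscale (of_real (x0 + x)) f" for f
      by (simp add: D_def algebra_simps del: of_real_add)
    then show ?thesis using e'[of "x0 + x"] that by (simp add: resolvent_set_iff)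
  qed
  have "\<exists>s. D s = D f \<and> e * norm s \<le> norm (D f)" for f
    using symmetric_bounded_solution[of D "e / 2", OF linD symD _ inv] e(1) by simp
  then have sol: "\<exists>s. J s - x0 *\<^sub>R s = J f - x0 *\<^sub>R f \<and> norm s \<le> 1 / e * norm (J f - x0 *\<^sub>R f)" for f
    using e(1) by (simp add: D_def field_simps)
  obtain c d where cd: "c > 0" "d > 0"
    "\<And>x f. \<bar>x - x0\<bar> \<le> d \<Longrightarrow> c * norm f \<le> norm (damped (of_real x) f)"
    using damped_bounded_below[OF _ sol] e(1) by fastforce
  define x where "x = x0 + min d (min (c / 2) (e / 2))"
  have x: "x \<noteq> x0" "\<bar>x - x0\<bar> \<le> d" "\<bar>x - x0\<bar> < c" "\<bar>x - x0\<bar> < e"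
    using cd e(1) by (auto simp: x_def)
  have "bij (\<lambda>f. damped (of_real x) f - cscale (of_real (x0 - x)) f)"
    by (rule boundedly_invertible_cscale_shift(1)[OF linear_damped damped_bij[OF e'] cd(3)])
      (use x in \<open>auto simp del: of_real_diff\<close>)
  moreover have "damped (of_real x) f - cscale (of_real (x0 - x)) f = damped (of_real x0) f" for f
    by (simp add: damped_def algebra_simps del: of_real_diff)
  ultimately show ?thesis
    using cd unfolding boundedly_invertible_def by auto
qed

end

section \<open>Solutions away from the first site\<close>

context block_jacobi
begin

text \<open>
  Square-summable solutions \<open>F = weyl z v\<close> of the eigenvalue equation at all sites but the first.  The
  matrix \<open>weyl_value\<close> maps \<open>v\<close> to \<open>first F\<close>, and \<open>weyl_source\<close> maps \<open>v\<close> to the defect at the first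
  site, \<open>(J - z) F = site (weyl_source z *v v)\<close>.  The primed matrices are the derivatives in \<open>z\<close>, which come from
  \<open>inv (damped z) F\<close>, the derivative of \<open>F\<close>.
\<close>

definition weyl :: "complex \<Rightarrow> complex ^ 'l \<Rightarrow> 'l lseq" where
  "weyl z v = inv (damped z) (site v)"

definition weyl_value :: "complex \<Rightarrow> complex ^ 'l ^ 'l" where
  "weyl_value z = matrix (\<lambda>v. first (weyl z v))"

definition weyl_source :: "complex \<Rightarrow> complex ^ 'l ^ 'l" where
  "weyl_source z = matrix (\<lambda>v. v - \<i> *s first (weyl z v))"

definition weyl_value' :: "complex \<Rightarrow> complex ^ 'l ^ 'l" where
  "weyl_value' z = matrix (\<lambda>v. first (inv (damped z) (weyl z v)))"

definition weyl_source' :: "complex \<Rightarrow> complex ^ 'l ^ 'l" where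
  "weyl_source' z = matrix (\<lambda>v. - \<i> *s first (inv (damped z) (weyl z v)))"

context
  fixes z assumes bij: "bij (damped z)"
begin

lemma damped_inv [simp]: "damped z (inv (damped z) f) = f"
  using bij by (simp add: bij_is_surj surj_f_inv_f)

lemma inv_damped_eqI: "damped z g = f \<Longrightarrow> inv (damped z) f = g"
  using bij by (simp add: inv_f_eq bij_is_inj)

lemma inv_damped_add: "inv (damped z) (f + g) = inv (damped z) f + inv (damped z) g"
  by (rule inv_damped_eqI) (simp add: damped_add)

lemma inv_damped_cscale: "inv (damped z) (cscale c f) = cscale c (inv (damped z) f)"
  by (rule inv_damped_eqI) (simp add: damped_cscale)

lemma weyl_add: "weyl z (v + w) = weyl z v + weyl z w"
  by (simp add: weyl_def inv_damped_add)

lemma weyl_scale: "weyl z (c *s v) = cscale c (weyl z v)"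
  by (simp add: weyl_def inv_damped_cscale)

lemma damped_weyl [simp]: "damped z (weyl z v) = site v"
  by (simp add: weyl_def)

lemma weyl_eq_0: "weyl z v = 0 \<Longrightarrow> v = 0"
  using damped_weyl[of v] linear_0[OF linear_damped] first_simps(7)[of v] by simp

lemma weyl_eqI: "damped z f = site v \<Longrightarrow> weyl z v = f"
  unfolding weyl_def by (rule inv_damped_eqI)

lemma coefficient_matrices_mult:
  "weyl_value z *v v = first (weyl z v)" "weyl_source z *v v = v - \<i> *s first (weyl z v)"
  "weyl_value' z *v v = first (inv (damped z) (weyl z v))"
  "weyl_source' z *v v = - \<i> *s first (inv (damped z) (weyl z v))"
  unfolding weyl_source_def weyl_value_def weyl_source'_def weyl_value'_def
  by (subst matrix_works; (rule refl)?; unfold_locales;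
      simp add: weyl_add weyl_scale inv_damped_add inv_damped_cscale vec_eq_iff algebra_simps)+

lemma J_weyl: "J (weyl z v) - cscale z (weyl z v) = site (weyl_source z *v v)"
  using damped_weyl[of v] by (simp add: damped_def coefficient_matrices_mult algebra_simps)

lemma J_weyl':
  "J (inv (damped z) (weyl z v)) - cscale z (inv (damped z) (weyl z v)) = weyl z v + site (weyl_source' z *v v)"
  using damped_inv[of "weyl z v"] by (simp add: damped_def coefficient_matrices_mult algebra_simps)

end

text \<open>
  At a real point the symmetric operator \<open>D = J - z\<close> has no Jordan chains.  For \<open>F = weyl z k\<close> the vector
  \<open>G\<close>, the derivative of \<open>F\<close> minus \<open>weyl z k'\<close>, satisfies \<open>D G = F + site w\<close>, where \<open>w\<close> is the difference
  of the source terms.  In the first case \<open>w = 0\<close> and \<open>D F = 0\<close>; in the second case \<open>F\<close> and \<open>G\<close> vanish at the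
  first site.  In both cases pairing \<open>D G\<close> with \<open>F\<close> and using symmetry yields that \<open>F\<close> has norm \<open>0\<close>.
\<close>

lemma weyl_no_jordan_chain:
  fixes x :: real
  defines "z \<equiv> of_real x"
  assumes bij: "bij (damped z)"
  shows "weyl_source z *v k = 0 \<Longrightarrow> weyl_source' z *v k = weyl_source z *v k' \<Longrightarrow> k = 0"
    and "weyl_value z *v k = 0 \<Longrightarrow> weyl_value' z *v k = weyl_value z *v k' \<Longrightarrow> k = 0"
proof -
  define D where "D = (\<lambda>f. J f - cscale z f)"
  define G where "G = inv (damped z) (weyl z k) - weyl z k'"
  have symD: "inner (D f) g = inner f (D g)" for f g
    by (simp add: D_def z_def inner_diff_left inner_diff_right J_symmetric)
  have DG: "D G = weyl z k + site (weyl_source' z *v k - weyl_source z *v k')"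
    using J_weyl'[OF bij, of k] J_weyl[OF bij, of k']
    by (simp add: D_def G_def linear_diff[OF linear_J] cscale_distrib algebra_simps)
  have DF: "D (weyl z k) = site (weyl_source z *v k)" by (simp add: D_def J_weyl[OF bij])
  have first_G: "first G = weyl_value' z *v k - weyl_value z *v k'"
    by (simp add: G_def coefficient_matrices_mult[OF bij])
  {
    assume "weyl_source z *v k = 0" "weyl_source' z *v k = weyl_source z *v k'"
    then have "inner (weyl z k) (weyl z k) = 0"
      using symD[of G "weyl z k"] by (simp add: DG DF)
    then show "k = 0" using weyl_eq_0[OF bij] by simp
  next
    assume "weyl_value z *v k = 0" "weyl_value' z *v k = weyl_value z *v k'"
    then have "inner (weyl z k) (weyl z k) = 0"
      using symD[of G "weyl z k"] coefficient_matrices_mult(1)[OF bij, of k]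
      by (simp add: DG DF inner_add_left inner_diff_left inner_site first_G inner_site')
    then show "k = 0" using weyl_eq_0[OF bij] by simp
  }
qed

text \<open>
  The resolvent identity for \<open>damped\<close> turns the difference quotient of \<open>weyl\<close> at \<open>z\<close> and \<open>w\<close> into
  \<open>inv (damped w) (weyl z v)\<close>, and a second application bounds its distance to the limit by a multiple of
  \<open>norm (z - w)\<close>.
\<close>

lemma weyl_derivative:
  assumes U: "open U" "w \<in> U" and c: "c > 0"
    and inv: "\<And>z. z \<in> U \<Longrightarrow> bij (damped z)" "\<And>z f. z \<in> U \<Longrightarrow> c * norm f \<le> norm (damped z f)"
  shows "((\<lambda>z. first (weyl z v) $ i) has_field_derivative first (inv (damped w) (weyl w v)) $ i) (at w)"
proof -
  note bw = inv(1)[OF U(2)]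
  have inv_le: "norm (inv (damped z) f) \<le> norm f / c" if "z \<in> U" for z f
    using inv(2)[OF that, of "inv (damped z) f"] inv(1)[OF that] c by (simp add: damped_inv field_simps)
  have weyl_diff: "weyl z v - weyl w v = cscale (z - w) (inv (damped w) (weyl z v))" if "z \<in> U" for z
  proof -
    have "damped w (weyl z v - cscale (z - w) (inv (damped w) (weyl z v)))
        = damped w (weyl z v) - cscale (z - w) (weyl z v)"
      by (simp add: linear_diff[OF linear_damped] damped_cscale damped_inv[OF bw])
    also have "\<dots> = site v"
      using damped_shift[of z "weyl z v" w] by (simp add: damped_weyl[OF inv(1)[OF that]] flip: damped_shift[of z _ w])
    finally show ?thesis using weyl_eqI[OF bw] by (metis add_diff_cancel_left' diff_add_cancel)
  qed
  define D where "D = first (inv (damped w) (weyl w v)) $ i"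
  have near: "norm ((first (weyl z v) $ i - first (weyl w v) $ i) / (z - w) - D)
      \<le> norm (z - w) * (norm v / c / c / c)" if z: "z \<in> U" "z \<noteq> w" for z
  proof -
    have "first (weyl z v) - first (weyl w v) = (z - w) *s first (inv (damped w) (weyl z v))"
      using arg_cong[OF weyl_diff[OF z(1)], of first] by simp
    then have "first (weyl z v) $ i - first (weyl w v) $ i = (z - w) * first (inv (damped w) (weyl z v)) $ i"
      by (metis vector_minus_component vector_smult_component)
    then have "(first (weyl z v) $ i - first (weyl w v) $ i) / (z - w) = first (inv (damped w) (weyl z v)) $ i"
      using z(2) by simp
    then have "(first (weyl z v) $ i - first (weyl w v) $ i) / (z - w) - D
        = first (inv (damped w) (weyl z v - weyl w v)) $ i"
      using inv_damped_add[OF bw, of "weyl z v" "- weyl w v"] inv_damped_cscale[OF bw, of "-1" "weyl w v"]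
      by (simp add: D_def)
    also have "norm \<dots> \<le> norm (inv (damped w) (weyl z v - weyl w v))"
      by (rule order_trans[OF Finite_Cartesian_Product.norm_nth_le norm_first_le])
    also have "\<dots> \<le> norm (weyl z v - weyl w v) / c" by (rule inv_le[OF U(2)])
    also have "\<dots> = norm (z - w) * norm (inv (damped w) (weyl z v)) / c" by (simp add: weyl_diff[OF z(1)])
    also have "\<dots> \<le> norm (z - w) * (norm (weyl z v) / c) / c"
      using c by (intro divide_right_mono mult_left_mono inv_le[OF U(2)]) auto
    also have "\<dots> \<le> norm (z - w) * (norm v / c / c) / c"
      using c inv_le[OF z(1), of "site v"] by (intro divide_right_mono mult_left_mono) (auto simp: weyl_def)
    finally show ?thesis by simp
  qed
  have "((\<lambda>z. norm (z - w) * (norm v / c / c / c)) \<longlongrightarrow> norm (w - w) * (norm v / c / c / c)) (at w)"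
    by (intro tendsto_intros)
  then have lim: "((\<lambda>z. norm (z - w) * (norm v / c / c / c)) \<longlongrightarrow> 0) (at w)" by simp
  have "((\<lambda>z. (first (weyl z v) $ i - first (weyl w v) $ i) / (z - w) - D) \<longlongrightarrow> 0) (at w)"
    by (rule Lim_null_comparison[OF _ lim])
      (use U near in \<open>auto simp: eventually_at_topological\<close>)
  then show ?thesis
    unfolding has_field_derivative_iff D_def[symmetric] by (rule LIM_zero_cancel)
qed

lemma coefficient_matrices_derivative:
  assumes U: "open U" "w \<in> U" and c: "c > 0"
    and inv: "\<And>z. z \<in> U \<Longrightarrow> bij (damped z)" "\<And>z f. z \<in> U \<Longrightarrow> c * norm f \<le> norm (damped z f)"
  shows "((\<lambda>z. weyl_value z $ i $ j) has_field_derivative weyl_value' w $ i $ j) (at w)"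
    and "((\<lambda>z. weyl_source z $ i $ j) has_field_derivative weyl_source' w $ i $ j) (at w)"
proof -
  note der = weyl_derivative[OF assms, of "axis j 1" i]
  show "((\<lambda>z. weyl_value z $ i $ j) has_field_derivative weyl_value' w $ i $ j) (at w)"
    using der by (simp add: weyl_value_def weyl_value'_def matrix_def)
  show "((\<lambda>z. weyl_source z $ i $ j) has_field_derivative weyl_source' w $ i $ j) (at w)"
    unfolding weyl_source_def weyl_source'_def matrix_def by (auto intro!: derivative_eq_intros der)
qed

text \<open>
  By the source equation, \<open>weyl z v\<close> is the resolvent of \<open>J\<close> applied to \<open>weyl_source z *v v\<close> at the first
  site.
\<close>

lemma m_function_mult_weyl_source:
  assumes z: "z \<in> resolvent_set (jacobi_op A B)" and bij: "bij (damped z)"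
  shows "m_function A B z ** weyl_source z = weyl_value z"
proof -
  define T where "T = (\<lambda>f. J f - cscale z f)"
  define R where "R v = inv T (site v)" for v
  have bT: "bij T" using z unfolding resolvent_set_iff boundedly_invertible_def T_def by blast
  have TR: "T (R v) = site v" for v using bT by (simp add: R_def bij_is_surj surj_f_inv_f)
  have R_eqI: "R v = f" if "T f = site v" for v f
    using that bT by (simp add: R_def inv_f_eq bij_is_inj)
  have res: "resolvent (jacobi_op A B) z (first_site v) 1 = first (R v)" for v
    using resolvent_eqI[OF z, of "R v" "site v"] TR[of v] by (simp add: T_def site.rep_eq first_def)
  have T_add: "T (f + g) = T f + T g" and T_cscale: "T (cscale c f) = cscale c (T f)" for f g c
    by (simp_all add: T_def J_add J_cscale cscale_distrib mult.commute)
  have R_add: "R (v + w) = R v + R w" and R_scale: "R (c *s v) = cscale c (R v)" for v w c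
    by (rule R_eqI; simp add: T_add T_cscale TR)+
  have "m_function A B z = matrix (\<lambda>v. first (R v))"
    unfolding m_function_def matrix_def res ..
  then have m: "m_function A B z *v v = first (R v)" for v
    by (simp only:, subst matrix_works) (unfold_locales; simp add: R_add R_scale)+
  have "R (weyl_source z *v v) = weyl z v" for v
    by (rule R_eqI) (simp add: T_def J_weyl[OF bij])
  then have "(m_function A B z ** weyl_source z) *v v = weyl_value z *v v" for v
    by (simp add: m coefficient_matrices_mult(1)[OF bij] flip: matrix_vector_mul_assoc)
  then show ?thesis by (simp add: matrix_eq)
qed

text \<open>
  A vector in the kernel of \<open>weyl_source\<close> produces a solution without source, that is, an eigenvector of \<open>J\<close>;
  conversely an eigenvector \<open>g\<close> is the solution that belongs to \<open>\<i> first g\<close>.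
\<close>

lemma dim_kernel_weyl_source:
  assumes bij: "bij (damped z)"
  shows "seqs.dim (eigenspace (jacobi_op A B) z) = vec.dim {k. weyl_source z *v k = 0}"
proof -
  define \<phi> where "\<phi> k = Rep_lseq (weyl z k)" for k
  interpret dim: finite_dimensional_vector_space_pair_1 "(*s) :: complex \<Rightarrow> complex ^ 'l \<Rightarrow> _" cart_basis
    "seq_scale :: complex \<Rightarrow> (nat \<Rightarrow> complex ^ 'l) \<Rightarrow> _" ..
  have lin: "Vector_Spaces.linear (*s) seq_scale \<phi>"
    by unfold_locales (simp_all add: \<phi>_def weyl_add[OF bij] weyl_scale[OF bij] plus_lseq.rep_eq cscale.rep_eq)
  have inj: "inj \<phi>"
    unfolding \<phi>_def
    by (rule injI) (metis Rep_lseq_inject damped_weyl[OF bij] first_simps(7))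
  have "\<phi> ` {k. weyl_source z *v k = 0} = eigenspace (jacobi_op A B) z"
  proof (intro equalityI subsetI)
    fix f assume "f \<in> \<phi> ` {k. weyl_source z *v k = 0}"
    then obtain k where k: "f = Rep_lseq (weyl z k)" "weyl_source z *v k = 0" by (auto simp: \<phi>_def)
    then have "J (weyl z k) = cscale z (weyl z k)" using J_weyl[OF bij, of k] by simp
    then show "f \<in> eigenspace (jacobi_op A B) z"
      unfolding eigenspace_def k(1) by (simp add: Rep_lseq flip: Rep_J cscale.rep_eq)
  next
    fix f assume f: "f \<in> eigenspace (jacobi_op A B) z"
    define g where "g = Abs_lseq f"
    have Rg: "Rep_lseq g = f" using f by (simp add: g_def eigenspace_def Abs_lseq_inverse)
    have "J g = cscale z g"
      using f by (simp add: eigenspace_def Rep_J cscale.rep_eq Rg flip: Rep_lseq_inject)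
    then have "weyl z (\<i> *s first g) = g"
      by (intro weyl_eqI[OF bij]) (simp add: damped_def)
    then show "f \<in> \<phi> ` {k. weyl_source z *v k = 0}"
      by (intro image_eqI[of _ _ "\<i> *s first g"]) (simp_all add: \<phi>_def Rg coefficient_matrices_mult[OF bij])
  qed
  then show ?thesis
    using dim.dim_image_eq[OF lin inj_on_subset[OF inj subset_UNIV]] by metis
qed

text \<open>
  A solution that vanishes at the first site is, after removal of this site, an eigenvector of the
  stripped matrix.  Conversely, an eigenvector \<open>g\<close> of the stripped matrix, preceded by \<open>0\<close>, solves the
  equation with source \<open>A 1 *v g 1\<close>.
\<close>

lemma dim_kernel_weyl_value:
  assumes bij: "bij (damped z)"
  shows "seqs.dim (eigenspace (stripped_jacobi_op 1 A B) z) = vec.dim {k. weyl_value z *v k = 0}"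
proof -
  define K where "K = {k. weyl_value z *v k = 0}"
  define \<phi> where "\<phi> k = (\<lambda>n. Rep_lseq (weyl z k) (Suc n))" for k
  interpret dim: finite_dimensional_vector_space_pair_1 "(*s) :: complex \<Rightarrow> complex ^ 'l \<Rightarrow> _" cart_basis
    "seq_scale :: complex \<Rightarrow> (nat \<Rightarrow> complex ^ 'l) \<Rightarrow> _" ..
  have lin: "Vector_Spaces.linear (*s) seq_scale \<phi>"
    by unfold_locales (simp_all add: \<phi>_def weyl_add[OF bij] weyl_scale[OF bij] plus_lseq.rep_eq
        cscale.rep_eq seq_scale_def fun_eq_iff)
  have K: "vec.subspace K"
    by (auto simp: K_def vec.subspace_def matrix_vector_right_distrib vector_scalar_commute)
  have inj: "inj_on \<phi> (vec.span K)"
  proof (rule inj_onI)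
    fix k k' assume "k \<in> vec.span K" "k' \<in> vec.span K" and eq: "\<phi> k = \<phi> k'"
    have "Rep_lseq (weyl z k) n = Rep_lseq (weyl z k') n" for n
      using eq by (cases n) (auto simp: \<phi>_def fun_eq_iff)
    then have "weyl z k = weyl z k'" by (simp add: fun_eq_iff flip: Rep_lseq_inject)
    then show "k = k'" by (metis damped_weyl[OF bij] first_simps(7))
  qed
  have "\<phi> ` K = eigenspace (stripped_jacobi_op 1 A B) z"
  proof (intro equalityI subsetI)
    fix g assume "g \<in> \<phi> ` K"
    then obtain k where k: "g = \<phi> k" "k \<in> K" by auto
    let ?f = "Rep_lseq (weyl z k)"
    have f1: "?f (Suc 0) = 0"
      using k(2) by (simp add: K_def coefficient_matrices_mult[OF bij] first_def)
    have "g \<in> ell2"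
      using summable_norm_lseq[of "weyl z k"] f1 by (simp add: ell2_def k(1) \<phi>_def summable_Suc_iff[of "\<lambda>n. (norm (?f n))\<^sup>2"])
    moreover have "stripped_jacobi_op 1 A B g n = z *s g n" for n
    proof (cases n)
      case (Suc m)
      have "jacobi_op A B ?f (Suc n) - z *s ?f (Suc n) = first_site (weyl_source z *v k) (Suc n)"
        using arg_cong[OF J_weyl[OF bij, of k], of "\<lambda>h. Rep_lseq h (Suc n)"]
        by (simp add: minus_lseq.rep_eq Rep_J cscale.rep_eq seq_scale_def site.rep_eq)
      then show ?thesis
        using Suc by (simp add: first_site_def stripped_jacobi_op_def jacobi_op_def k(1) \<phi>_def)
    qed (simp add: stripped_jacobi_op_def jacobi_op_def k(1) \<phi>_def f1)
    ultimately show "g \<in> eigenspace (stripped_jacobi_op 1 A B) z"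
      by (simp add: eigenspace_def seq_scale_def fun_eq_iff)
  next
    fix g assume "g \<in> eigenspace (stripped_jacobi_op 1 A B) z"
    then have g: "g 0 = 0" "summable (\<lambda>n. (norm (g n))\<^sup>2)" "\<And>n. stripped_jacobi_op 1 A B g n = z *s g n"
      by (auto simp: eigenspace_def seq_scale_def fun_eq_iff ell2_def)
    define f where "f = (\<lambda>n. g (n - 1))"
    have "f \<in> ell2"
      using g(1,2) summable_Suc_iff[of "\<lambda>n. (norm (f n))\<^sup>2"] by (simp add: ell2_def f_def)
    then obtain h where h: "Rep_lseq h = f" using Abs_lseq_inverse by blast
    have fh: "first h = 0" by (simp add: first_def h f_def g(1))
    have "Rep_lseq (J h - cscale z h) n = first_site (A 1 *v g 1) n" for n
    proof -
      consider "n = 0" | "n = 1" | m where "n = Suc (Suc m)" by (metis One_nat_def not0_implies_Suc)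
      then show ?thesis
      proof cases
        case 3
        then show ?thesis
          using g(3)[of "Suc m"]
          by (simp add: minus_lseq.rep_eq Rep_J cscale.rep_eq seq_scale_def h f_def first_site_def
              jacobi_op_def stripped_jacobi_op_def)
      qed (simp_all add: minus_lseq.rep_eq Rep_J cscale.rep_eq seq_scale_def h f_def first_site_def
              jacobi_op_def g(1))
    qed
    then have "J h - cscale z h = site (A 1 *v g 1)"
      by (simp add: fun_eq_iff site.rep_eq flip: Rep_lseq_inject)
    then have "weyl z (A 1 *v g 1) = h"
      by (intro weyl_eqI[OF bij]) (simp add: damped_def fh)
    then show "g \<in> \<phi> ` K"
      by (intro image_eqI[of _ _ "A 1 *v g 1"])
        (simp_all add: \<phi>_def K_def h f_def fh coefficient_matrices_mult[OF bij])
  qed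
  then show ?thesis
    using dim.dim_image_eq[OF lin inj] unfolding K_def by metis
qed

text \<open>
  Near the point \<open>det (m_function A B z)\<close> is the quotient of \<open>det (weyl_value z)\<close> and \<open>det (weyl_source z)\<close>, whose orders of
  vanishing are the two multiplicities.
\<close>

lemma order_det_m_function:
  assumes "of_real x \<notin> ess_spectrum (jacobi_op A B)"
  defines "p \<equiv> multiplicity_eigval (jacobi_op A B) (of_real x)"
    and "q \<equiv> multiplicity_eigval (stripped_jacobi_op 1 A B) (of_real x)"
  shows "(p \<le> q \<longrightarrow> has_zero_of_order (\<lambda>z. det (m_function A B z)) (of_real x) (q - p)) \<and>
         (q < p \<longrightarrow> has_pole_of_order (\<lambda>z. det (m_function A B z)) (of_real x) (p - q))"
proof -
  define z0 :: complex where "z0 = of_real x"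
  obtain c where bij0: "bij (damped z0)" and c: "c > 0" "\<And>f. c * norm f \<le> norm (damped z0 f)"
    using damped_boundedly_invertible[OF assms(1)] unfolding boundedly_invertible_def z0_def by blast
  obtain e where e: "e > 0" "\<And>z. z \<in> ball z0 e \<Longrightarrow> z \<noteq> z0 \<Longrightarrow> z \<in> resolvent_set (jacobi_op A B)"
    using resolvent_set_punctured_nhd assms(1) unfolding z0_def by metis
  \<comment> \<open>the radius \<open>c / 2\<close> keeps half of the lower bound uniformly on \<open>U\<close>\<close>
  define U where "U = ball z0 (min e (c / 2))"
  have U: "open U" "z0 \<in> U" using e(1) c(1) by (auto simp: U_def)
  have shift: "damped z0 f - cscale (z - z0) f = damped z f" for z f
    by (simp add: damped_def cscale_distrib)
  have inv: "bij (damped z)" "c / 2 * norm f \<le> norm (damped z f)" if "z \<in> U" for z f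
  proof -
    have t: "norm (z - z0) < c / 2" using that by (simp add: U_def dist_norm norm_minus_commute)
    then have t': "norm (z - z0) < c" using c(1) by simp
    note * = boundedly_invertible_cscale_shift[OF linear_damped bij0 c(2) t', unfolded shift]
    show "bij (damped z)" by (rule *)
    have "c / 2 * norm f \<le> (c - norm (z - z0)) * norm f"
      using t by (intro mult_right_mono) auto
    also have "\<dots> \<le> norm (damped z f)" by (rule *)
    finally show "c / 2 * norm f \<le> norm (damped z f)" .
  qed
  have c2: "c / 2 > 0" using c(1) by simp
  have der: "((\<lambda>z. weyl_value z $ i $ j) has_field_derivative weyl_value' w $ i $ j) (at w)"
    "((\<lambda>z. weyl_source z $ i $ j) has_field_derivative weyl_source' w $ i $ j) (at w)" if "w \<in> U" for w i j
    by (rule coefficient_matrices_derivative[OF U(1) that c2 inv]; assumption)+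
  have hol: "(\<lambda>z. weyl_value z $ i $ j) holomorphic_on U" "(\<lambda>z. weyl_source z $ i $ j) holomorphic_on U" for i j
    unfolding holomorphic_on_open[OF U(1)] using der by blast+
  note simple = weyl_no_jordan_chain[of x, folded z0_def, OF bij0]
  obtain g where g: "g holomorphic_on U" "g z0 \<noteq> 0"
    "\<And>z. z \<in> U \<Longrightarrow> det (weyl_source z) = (z - z0) ^ vec.dim {k. weyl_source z0 *v k = 0} * g z"
    by (rule det_zero_order_kernel[of U z0 weyl_source "weyl_source' z0", OF U hol(2) der(2)[OF U(2)]])
      (use simple(1) in blast)+
  obtain h where h: "h holomorphic_on U" "h z0 \<noteq> 0"
    "\<And>z. z \<in> U \<Longrightarrow> det (weyl_value z) = (z - z0) ^ vec.dim {k. weyl_value z0 *v k = 0} * h z"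
    by (rule det_zero_order_kernel[of U z0 weyl_value "weyl_value' z0", OF U hol(1) der(1)[OF U(2)]])
      (use simple(2) in blast)+
  have pq: "p = vec.dim {k. weyl_source z0 *v k = 0}" "q = vec.dim {k. weyl_value z0 *v k = 0}"
    using dim_kernel_weyl_source[OF bij0] dim_kernel_weyl_value[OF bij0]
    by (simp_all add: p_def q_def multiplicity_eigval_def z0_def)
  show ?thesis
    unfolding z0_def[symmetric]
  proof (rule order_of_quotient[OF U g(1,2) h(1,2)])
    fix z assume z: "z \<in> U" "z \<noteq> z0"
    then have "z \<in> resolvent_set (jacobi_op A B)" by (intro e(2)) (auto simp: U_def)
    from m_function_mult_weyl_source[OF this inv(1)[OF z(1)]]
    have "det (m_function A B z) * det (weyl_source z) = det (weyl_value z)" by (metis det_mul)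
    then show "det (m_function A B z) * ((z - z0) ^ p * g z) = (z - z0) ^ q * h z"
      using g(3)[OF z(1)] h(3)[OF z(1)] by (simp add: pq)
  qed
qed

end

theorem theorem2p28:
  fixes A B :: "nat \<Rightarrow> complex ^ 'l ^ 'l"
    and z0 :: real
    and q :: "nat \<Rightarrow> nat"
  assumes "jacobi_params A B"
    and "complex_of_real z0 \<notin> ess_spectrum (jacobi_op A B)"
    and "\<And>k. k \<in> {0, 1} \<Longrightarrow>
           q k = multiplicity_eigval (stripped_jacobi_op k A B) (complex_of_real z0)"
  shows "(q 0 \<le> q 1 \<longrightarrow>
            has_zero_of_order (\<lambda>z. det (m_function A B z)) (complex_of_real z0) (q 1 - q 0)) \<and>
         (q 1 < q 0 \<longrightarrow>
            has_pole_of_order (\<lambda>z. det (m_function A B z)) (complex_of_real z0) (q 0 - q 1))"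
proof -
  interpret block_jacobi A B by unfold_locales (rule assms(1))
  have "stripped_jacobi_op 0 A B = jacobi_op A B" by (simp add: stripped_jacobi_op_def)
  then have "q 0 = multiplicity_eigval (jacobi_op A B) (of_real z0)"
    "q 1 = multiplicity_eigval (stripped_jacobi_op 1 A B) (of_real z0)"
    using assms(3)[of 0] assms(3)[of 1] by simp_all
  then show ?thesis using order_det_m_function[OF assms(2)] by simp
qed

end
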